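(* Let $\mathcal{X}=\{X_i\}_{i\in\mathbb{N}}$ be a sequence of finite graphs with uniformly bounded degree and let $X$ be the related space of graphs. If the coarse boundary groupoid $\partial G(X)$ is topologically a-T-menable, then the sequence of graphs $\mathcal{X}$ is asymptotically coarsely embeddable into a Hilbert space $\mathcal{H}$.
   Context: Space of graphs and coarse boundary groupoid. The sequence satisfies $|X_i|\to\infty$ (part of the definition of a space of graphs); each graph carries its path-length metric. The space of graphs $X=\bigsqcup_i X_i$ carries a metric $d$ restricting to the path-length metric on each $X_i$ and with $d(X_i,X_j)\to\infty$ as $i+j\to\infty$, $i\neq j$. Let $\beta X$ be the Stone–Čech compactification of the discrete set $X$, $\partial\beta X=\beta X\setminus X$. For $R>0$ let $E_R=\{(x,y)\in X\times X:d(x,y)\le R\}$, with closure $\overline{E_R}$ in $\beta X\times\beta X$. The coarse groupoid is $G(X)=\bigcup_{R>0}\overline{E_R}$ with unit space $\beta X$, $r(\xi,\eta)=\xi$, $s(\xi,\eta)=\eta$, $(\xi,\eta)(\eta,\zeta)=(\xi,\zeta)$; a set is open iff its intersection with each $\overline{E_R}$ is open in $\overline{E_R}$, making $G(X)$ a locally compact Hausdorff étale groupoid. The coarse boundary groupoid is $\partial G(X)=G(X)\cap(\partial\beta X\times\partial\beta X)$ with unit space $\partial\beta X$. A map $\psi:G\to\mathbb{R}$ on a groupoid is a conditionally negative definite function if $\psi$ vanishes on units, $\psi(\gamma)=\psi(\gamma^{-1})$ for all $\gamma$, and for every unit $x$, all $y_1,\dots,y_n\in G^x=r^{-1}(x)$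 and reals $\lambda_1,\dots,\lambda_n$ with $\sum_i\lambda_i=0$ one has $\sum_{i,j}\lambda_i\lambda_j\psi(y_i^{-1}y_j)\le0$. A locally compact Hausdorff groupoid is topologically a-T-menable if it admits a continuous conditionally negative definite function that is proper (preimages of compact sets are compact). $\mathcal{X}$ is asymptotically coarsely embeddable into a Hilbert space if there are symmetric kernels $K_i:X_i\times X_i\to\mathbb{R}$, non-decreasing functions $\rho_1,\rho_2:\mathbb{R}_+\to\mathbb{R}$ tending to infinity at infinity, and non-negative reals $R_i\to\infty$ such that: (1) for every sequence $x_i\in X_i$, $K_i(x_i,x_i)\to0$ as $i\to\infty$; (2) $\rho_1(d(x,y))\le K_i(x,y)\le\rho_2(d(x,y))$ for all $i$ and $x,y\in X_i$; (3) for every $i$, every subset $\{x_1,\dots,x_n\}\subseteq X_i$ of diameter smaller than $2R_i$ and all reals $\lambda_k$ with $\sum_k\lambda_k=0$, $\sum_{k,l}\lambda_k\lambda_lK_i(x_k,x_l)\le0$. *)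

theory Defs
  imports
    "HOL-Analysis.Analysis"
    "Graph_Theory.Digraph_Component"
    "Graph_Theory.Shortest_Path"
begin

section \<open>Spaces of graphs\<close>

text \<open>Path-length metric: the infimum of the lengths of walks, i.e. all arcs have cost 1.\<close>

definition path_metric :: "('v, 'e) pre_digraph \<Rightarrow> 'v \<Rightarrow> 'v \<Rightarrow> real" where
  "path_metric G u v = real_of_ereal (wf_digraph.\<mu> G (\<lambda>_. 1) u v)"

text \<open>In a symmetric digraph without loops and multiple arcs the out-degree of a vertex is its
  degree in the undirected sense.\<close>

definition uniformly_bounded_degree :: "(nat \<Rightarrow> ('v, 'e) pre_digraph) \<Rightarrow> bool" where
  "uniformly_bounded_degree X \<longleftrightarrow> (\<exists>D. \<forall>i. \<forall>v\<in>verts (X i). out_degree (X i) v \<le> D)"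

definition coarse_union :: "(nat \<Rightarrow> ('v, 'e) pre_digraph) \<Rightarrow> (nat \<times> 'v) set" where
  "coarse_union X = (SIGMA i:UNIV. verts (X i))"

text \<open>Connectedness is what makes the path-length metric finite.\<close>

locale space_of_graphs =
  fixes X :: "nat \<Rightarrow> ('v, 'e) pre_digraph"
    and d :: "nat \<times> 'v \<Rightarrow> nat \<times> 'v \<Rightarrow> real"
  assumes finite_graph: "\<And>i. Digraph.graph (X i)"
    and connected_graph: "\<And>i. Digraph_Component.connected (X i)"
    and card_at_top: "filterlim (\<lambda>i. card (verts (X i))) at_top sequentially"
    and metric: "Metric_space (coarse_union X) d"
    and restricts: "\<And>i u v. \<lbrakk>u \<in> verts (X i); v \<in> verts (X i)\<rbrakk> \<Longrightarrow>
          d (i, u) (i, v) = path_metric (X i) u v"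
    and separated: "\<And>C. \<exists>N. \<forall>i j. i \<noteq> j \<and> N \<le> i + j \<longrightarrow>
          C \<le> (INF (u, v) \<in> verts (X i) \<times> verts (X j). d (i, u) (j, v))"


section \<open>The Stone-Cech compactification of a discrete set\<close>

definition ultrafilter :: "'a filter \<Rightarrow> bool" where
  "ultrafilter F \<longleftrightarrow> F \<noteq> bot \<and> (\<forall>P. eventually P F \<or> eventually (\<lambda>x. \<not> P x) F)"

definition stone_cech :: "'a set \<Rightarrow> 'a filter set" where
  "stone_cech S = {F. ultrafilter F \<and> F \<le> principal S}"

definition stone_cech_basic :: "'a set \<Rightarrow> 'a set \<Rightarrow> 'a filter set" where
  "stone_cech_basic S A = {F \<in> stone_cech S. F \<le> principal A}"

definition stone_cech_topology :: "'a set \<Rightarrow> 'a filter topology" where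
  "stone_cech_topology S = topology_generated_by (stone_cech_basic S ` Pow S)"

text \<open>The inclusion of the discrete set into its compactification.\<close>

definition principal_ultrafilter :: "'a \<Rightarrow> 'a filter" where
  "principal_ultrafilter x = principal {x}"

definition stone_cech_boundary :: "'a set \<Rightarrow> 'a filter set" where
  "stone_cech_boundary S = stone_cech S - principal_ultrafilter ` S"

lemma ultrafilter_eventually_not:
  "ultrafilter F \<Longrightarrow> eventually (\<lambda>x. \<not> P x) F \<longleftrightarrow> \<not> eventually P F"
proof -
  assume u: "ultrafilter F"
  have "False" if "eventually (\<lambda>x. \<not> P x) F" "eventually P F"
  proof -
    have "eventually (\<lambda>x. False) F"
      using eventually_conj[OF that] by (rule eventually_mono) blast
    with u show False by (simp add: ultrafilter_def eventually_False)
  qed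
  with u show ?thesis by (auto simp: ultrafilter_def)
qed

lemma ultrafilter_le_principal_Compl:
  "ultrafilter F \<Longrightarrow> F \<le> principal (- A) \<longleftrightarrow> \<not> F \<le> principal A"
  using ultrafilter_eventually_not[of F "\<lambda>x. x \<in> A"] by (simp add: le_principal)

lemma stone_cech_basic_Int:
  "stone_cech_basic S A \<inter> stone_cech_basic S B = stone_cech_basic S (A \<inter> B)"
  by (auto simp: stone_cech_basic_def le_principal eventually_conj_iff)

lemma stone_cech_basic_top: "stone_cech_basic S S = stone_cech S"
  by (auto simp: stone_cech_basic_def stone_cech_def)

lemma topspace_stone_cech [simp]: "topspace (stone_cech_topology S) = stone_cech S"
proof -
  have "\<Union> (stone_cech_basic S ` Pow S) = stone_cech S"
    using stone_cech_basic_top[of S] by (auto simp: stone_cech_basic_def)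
  then show ?thesis by (simp add: stone_cech_topology_def)
qed

lemma openin_stone_cech_basic: "openin (stone_cech_topology S) (stone_cech_basic S A)"
proof -
  have "stone_cech_basic S A = stone_cech_basic S (A \<inter> S)"
    by (auto simp: stone_cech_basic_def stone_cech_def le_principal eventually_conj_iff)
  then show ?thesis
    unfolding stone_cech_topology_def
    by (metis Int_lower2 PowI imageI topology_generated_by_Basis)
qed

lemma openin_stone_cech_iff:
  "openin (stone_cech_topology S) U \<longleftrightarrow>
    U \<subseteq> stone_cech S \<and> (\<forall>F\<in>U. \<exists>A. F \<in> stone_cech_basic S A \<and> stone_cech_basic S A \<subseteq> U)"
proof
  assume U: "openin (stone_cech_topology S) U"
  then have "generate_topology_on (stone_cech_basic S ` Pow S) U"
    by (simp add: stone_cech_topology_def openin_topology_generated_by_iff)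
  then have "\<forall>F\<in>U. \<exists>A. F \<in> stone_cech_basic S A \<and> stone_cech_basic S A \<subseteq> U"
  proof induction
    case (Int a b)
    show ?case
    proof
      fix F assume "F \<in> a \<inter> b"
      with Int obtain A B where "F \<in> stone_cech_basic S A" "stone_cech_basic S A \<subseteq> a"
        "F \<in> stone_cech_basic S B" "stone_cech_basic S B \<subseteq> b" by blast
      then have "F \<in> stone_cech_basic S (A \<inter> B) \<and> stone_cech_basic S (A \<inter> B) \<subseteq> a \<inter> b"
        unfolding stone_cech_basic_Int[symmetric] by blast
      then show "\<exists>C. F \<in> stone_cech_basic S C \<and> stone_cech_basic S C \<subseteq> a \<inter> b" ..
    qed
  qed blast+
  with openin_subset[OF U]
  show "U \<subseteq> stone_cech S \<and>
      (\<forall>F\<in>U. \<exists>A. F \<in> stone_cech_basic S A \<and> stone_cech_basic S A \<subseteq> U)" by simp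
next
  assume r: "U \<subseteq> stone_cech S \<and>
      (\<forall>F\<in>U. \<exists>A. F \<in> stone_cech_basic S A \<and> stone_cech_basic S A \<subseteq> U)"
  show "openin (stone_cech_topology S) U"
    by (subst openin_subopen) (use r openin_stone_cech_basic in blast)
qed

lemma Hausdorff_stone_cech: "Hausdorff_space (stone_cech_topology S)"
  unfolding Hausdorff_space_def
proof (intro allI impI, elim conjE)
  fix F G assume FG: "F \<in> topspace (stone_cech_topology S)" "G \<in> topspace (stone_cech_topology S)"
    and "F \<noteq> G"
  then have u: "ultrafilter F" "ultrafilter G" by (auto simp: stone_cech_def)
  have "\<exists>A. F \<le> principal A \<and> \<not> G \<le> principal A"
  proof (rule ccontr)
    assume n: "\<not> ?thesis"
    have "eventually P F \<longleftrightarrow> eventually P G" for P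
    proof -
      have "F \<le> principal {x. P x} \<longleftrightarrow> G \<le> principal {x. P x}"
        using n u ultrafilter_le_principal_Compl by metis
      then show ?thesis by (simp add: le_principal)
    qed
    then have "F = G" by (simp add: filter_eq_iff)
    with \<open>F \<noteq> G\<close> show False by simp
  qed
  then obtain A where A: "F \<le> principal A" "\<not> G \<le> principal A" by blast
  then have "G \<le> principal (- A)" using u ultrafilter_le_principal_Compl by blast
  moreover have "disjnt (stone_cech_basic S A) (stone_cech_basic S (- A))"
    by (auto simp: disjnt_def stone_cech_basic_def stone_cech_def ultrafilter_le_principal_Compl)
  ultimately show "\<exists>U V. openin (stone_cech_topology S) U \<and> openin (stone_cech_topology S) V \<and>
      F \<in> U \<and> G \<in> V \<and> disjnt U V"
    using A FG openin_stone_cech_basic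
    by (intro exI[of _ "stone_cech_basic S A"] exI[of _ "stone_cech_basic S (- A)"])
       (auto simp: stone_cech_basic_def)
qed

lemma principal_ultrafilter_in_stone_cech:
  "x \<in> S \<Longrightarrow> principal_ultrafilter x \<in> stone_cech S"
  by (auto simp: stone_cech_def principal_ultrafilter_def ultrafilter_def eventually_principal
      principal_eq_bot_iff)

lemma ultrafilter_exists:
  assumes "F \<noteq> bot"
  shows "\<exists>U\<le>F. ultrafilter U"
proof -
  define A where "A = {G. G \<noteq> bot \<and> G \<le> F}"
  define P :: "'a filter \<Rightarrow> 'a filter \<Rightarrow> bool" where "P = (\<lambda>a b. b \<le> a)"
  have po: "partial_order_on A (relation_of P A)"
    by (rule partial_order_on_relation_ofI) (auto simp: P_def)
  have "\<exists>M\<in>A. \<forall>G\<in>A. P M G \<longrightarrow> G = M"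
  proof (rule predicate_Zorn[OF po])
    fix C assume C: "C \<in> Chains (relation_of P A)"
    then have sub: "C \<subseteq> A" and tot: "a \<le> b \<or> b \<le> a" if "a \<in> C" "b \<in> C" for a b
      using that by (auto simp: Chains_def relation_of_def P_def)
    show "\<exists>u\<in>A. \<forall>a\<in>C. P a u"
    proof (cases "C = {}")
      case True
      with assms show ?thesis by (auto simp: A_def)
    next
      case False
      have "Inf C \<noteq> bot"
      proof
        assume "Inf C = bot"
        then have "eventually (\<lambda>_. False) (Inf C)" by simp
        moreover have "eventually (\<lambda>_. False) (Inf C) \<longleftrightarrow> (\<exists>b\<in>C. eventually (\<lambda>_. False) b)"
          by (rule eventually_Inf_base[OF False]) (metis tot inf.absorb_iff1 inf.absorb2 order_refl)
        ultimately show False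
          using C by (auto simp: Chains_def relation_of_def A_def eventually_False)
      qed
      moreover obtain c where "c \<in> C" using False by blast
      then have "c \<le> F" using C by (auto simp: Chains_def relation_of_def A_def)
      then have "Inf C \<le> F" using \<open>c \<in> C\<close> Inf_lower order_trans by blast
      ultimately show ?thesis by (auto simp: A_def P_def Inf_lower intro!: bexI[of _ "Inf C"])
    qed
  qed
  then obtain M where M: "M \<in> A" and max: "\<And>G. G \<in> A \<Longrightarrow> G \<le> M \<Longrightarrow> G = M"
    by (auto simp: P_def)
  have "eventually Q M \<or> eventually (\<lambda>x. \<not> Q x) M" for Q
  proof (rule disjCI)
    assume n: "\<not> eventually (\<lambda>x. \<not> Q x) M"
    let ?G = "inf M (principal {x. Q x})"
    have "?G \<noteq> bot"
      using n by (simp add: trivial_limit_def eventually_inf_principal)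
    with M have "?G \<in> A" by (auto simp: A_def intro: le_infI1)
    then have "?G = M" using max by simp
    then have "M \<le> principal {x. Q x}" by (metis inf.cobounded2)
    then show "eventually Q M" by (simp add: le_principal)
  qed
  with M show ?thesis by (auto simp: A_def ultrafilter_def)
qed

lemma compact_stone_cech: "compact_space (stone_cech_topology S)"
  unfolding compact_space_fip
proof (intro allI impI, elim conjE)
  fix \<C> assume cl: "\<forall>C\<in>\<C>. closedin (stone_cech_topology S) C"
    and fip: "\<forall>\<F>. finite \<F> \<and> \<F> \<subseteq> \<C> \<longrightarrow> \<Inter> \<F> \<noteq> {}"
  show "\<Inter> \<C> \<noteq> {}"
  proof (cases "\<C> = {}")
    case False
    define B where "B = {A. \<exists>C\<in>\<C>. C \<subseteq> stone_cech_basic S A}"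
    obtain C0 where "C0 \<in> \<C>" using False by blast
    then have "C0 \<subseteq> stone_cech S" using cl closedin_subset by fastforce
    with \<open>C0 \<in> \<C>\<close> have SB: "S \<in> B" by (auto simp: B_def stone_cech_basic_top)
    have "(INF A\<in>B. principal A) \<noteq> bot"
    proof (rule INF_filter_not_bot)
      fix B' assume B': "B' \<subseteq> B" "finite B'"
      then have "\<forall>A\<in>B'. \<exists>C. C \<in> \<C> \<and> C \<subseteq> stone_cech_basic S A" by (auto simp: B_def)
      then obtain c where c: "\<And>A. A \<in> B' \<Longrightarrow> c A \<in> \<C> \<and> c A \<subseteq> stone_cech_basic S A"
        by (auto dest!: bchoice)
      have "finite (insert C0 (c ` B'))" using B'(2) by simp
      moreover have "insert C0 (c ` B') \<subseteq> \<C>" using c \<open>C0 \<in> \<C>\<close> by blast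
      ultimately have "\<Inter> (insert C0 (c ` B')) \<noteq> {}" using fip by blast
      then obtain G where G: "G \<in> C0" "\<And>A. A \<in> B' \<Longrightarrow> G \<in> c A" by auto
      then have "G \<noteq> bot"
        using \<open>C0 \<subseteq> stone_cech S\<close> by (auto simp: stone_cech_def ultrafilter_def)
      moreover have "G \<le> (INF A\<in>B'. principal A)"
      proof (rule INF_greatest)
        fix A assume "A \<in> B'"
        with G c have "G \<in> stone_cech_basic S A" by blast
        then show "G \<le> principal A" by (simp add: stone_cech_basic_def)
      qed
      ultimately show "(INF A\<in>B'. principal A) \<noteq> bot" by (auto dest: le_bot)
    qed
    then obtain F where F: "F \<le> (INF A\<in>B. principal A)" "ultrafilter F"
      using ultrafilter_exists by blast
    then have FA: "F \<le> principal A" if "A \<in> B" for A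
      using that by (meson INF_lower order_trans)
    then have FS: "F \<in> stone_cech S" using F SB by (auto simp: stone_cech_def)
    have "F \<in> C" if "C \<in> \<C>" for C
    proof (rule ccontr)
      assume "F \<notin> C"
      moreover have "openin (stone_cech_topology S) (stone_cech S - C)"
        using cl that by (metis openin_diff openin_topspace topspace_stone_cech)
      ultimately obtain A where A: "F \<in> stone_cech_basic S A"
        "stone_cech_basic S A \<subseteq> stone_cech S - C"
        using FS unfolding openin_stone_cech_iff by blast
      have "C \<subseteq> stone_cech_basic S (- A)"
      proof
        fix G assume "G \<in> C"
        with cl that have "G \<in> stone_cech S" using closedin_subset by fastforce
        moreover from this A \<open>G \<in> C\<close> have "\<not> G \<le> principal A"
          by (auto simp: stone_cech_basic_def)
        ultimately show "G \<in> stone_cech_basic S (- A)"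
          using ultrafilter_le_principal_Compl by (auto simp: stone_cech_basic_def stone_cech_def)
      qed
      with that have "- A \<in> B" by (auto simp: B_def)
      then have "F \<le> principal (- A)" by (rule FA)
      with A F show False
        using ultrafilter_le_principal_Compl by (auto simp: stone_cech_basic_def)
    qed
    then show ?thesis by blast
  qed simp
qed

lemma dense_stone_cech:
  "stone_cech_topology S closure_of (principal_ultrafilter ` S) = stone_cech S"
proof (rule antisym)
  show "stone_cech_topology S closure_of (principal_ultrafilter ` S) \<subseteq> stone_cech S"
    using closure_of_subset_topspace by fastforce
  show "stone_cech S \<subseteq> stone_cech_topology S closure_of (principal_ultrafilter ` S)"
  proof
    fix F assume F: "F \<in> stone_cech S"
    show "F \<in> stone_cech_topology S closure_of (principal_ultrafilter ` S)"
      unfolding in_closure_of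
    proof (intro conjI allI impI)
      show "F \<in> topspace (stone_cech_topology S)" using F by simp
      fix U assume "F \<in> U \<and> openin (stone_cech_topology S) U"
      then obtain A where A: "F \<in> stone_cech_basic S A" "stone_cech_basic S A \<subseteq> U"
        by (auto simp: openin_stone_cech_iff)
      then have "eventually (\<lambda>x. x \<in> A \<and> x \<in> S) F"
        using F by (auto simp: stone_cech_basic_def stone_cech_def le_principal eventually_conj_iff)
      moreover have "F \<noteq> bot" using F by (simp add: stone_cech_def ultrafilter_def)
      ultimately obtain x where x: "x \<in> A" "x \<in> S" using eventually_happens' by blast
      then have "principal_ultrafilter x \<in> stone_cech_basic S A"
        using principal_ultrafilter_in_stone_cech[OF x(2)]
        by (auto simp: stone_cech_basic_def principal_ultrafilter_def)
      with x A show "\<exists>y. y \<in> principal_ultrafilter ` S \<and> y \<in> U" by blast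
    qed
  qed
qed

text \<open>The universal property of the Stone-Cech compactification.\<close>

lemma stone_cech_extension:
  assumes Y: "compact_space Y" "Hausdorff_space Y" and f: "f ` S \<subseteq> topspace Y"
  shows "\<exists>g. continuous_map (stone_cech_topology S) Y g \<and>
    (\<forall>x\<in>S. g (principal_ultrafilter x) = f x)"
proof -
  have "\<exists>l. limitin Y f l F" if F: "F \<in> stone_cech S" for F
  proof (rule ccontr)
    assume no: "\<nexists>l. limitin Y f l F"
    have u: "ultrafilter F" and S: "eventually (\<lambda>x. x \<in> S) F"
      using F by (auto simp: stone_cech_def le_principal)
    let ?N = "{U. openin Y U \<and> eventually (\<lambda>x. f x \<notin> U) F}"
    have "topspace Y \<subseteq> \<Union> ?N"
    proof
      fix l assume "l \<in> topspace Y"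
      with no obtain U where "openin Y U" "l \<in> U" "\<not> eventually (\<lambda>x. f x \<in> U) F"
        by (auto simp: limitin_def)
      then show "l \<in> \<Union> ?N" using u ultrafilter_eventually_not by fastforce
    qed
    then obtain \<F> where \<F>: "finite \<F>" "\<F> \<subseteq> ?N" "topspace Y \<subseteq> \<Union> \<F>"
      using Y(1) unfolding compact_space_alt by (metis (no_types, lifting) mem_Collect_eq)
    then have "eventually (\<lambda>x. \<forall>U\<in>\<F>. f x \<notin> U) F"
      by (auto intro!: eventually_ball_finite)
    then have "eventually (\<lambda>x. False) F" using S
      by eventually_elim (use f \<F>(3) in blast)
    with u show False by (simp add: ultrafilter_def eventually_False)
  qed
  then obtain g where g: "\<And>F. F \<in> stone_cech S \<Longrightarrow> limitin Y f (g F) F" by metis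
  have "g (principal_ultrafilter x) = f x" if x: "x \<in> S" for x
  proof (rule limitin_Hausdorff_unique[OF g _ _ Y(2)])
    show "principal_ultrafilter x \<in> stone_cech S"
      using x by (rule principal_ultrafilter_in_stone_cech)
    show "limitin Y f (f x) (principal_ultrafilter x)"
      using f x by (auto simp: limitin_def principal_ultrafilter_def eventually_principal)
    show "\<not> trivial_limit (principal_ultrafilter x)"
      by (simp add: principal_ultrafilter_def principal_eq_bot_iff)
  qed
  moreover have "continuous_map (stone_cech_topology S) Y g"
    unfolding continuous_map_def
  proof (intro conjI allI impI)
    show "g \<in> topspace (stone_cech_topology S) \<rightarrow> topspace Y"
      using g by (auto simp: limitin_def)
    fix V assume V: "openin Y V"
    show "openin (stone_cech_topology S) {F \<in> topspace (stone_cech_topology S). g F \<in> V}"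
      unfolding openin_stone_cech_iff
    proof (intro conjI ballI)
      fix F assume "F \<in> {F \<in> topspace (stone_cech_topology S). g F \<in> V}"
      then have F: "F \<in> stone_cech S" "g F \<in> V" by auto
      have "neighbourhood_base_of (closedin Y) Y"
        using Y compact_Hausdorff_imp_regular_space neighbourhood_base_of_closedin by blast
      then obtain U C where UC: "openin Y U" "closedin Y C" "g F \<in> U" "U \<subseteq> C" "C \<subseteq> V"
        using V F(2) unfolding neighbourhood_base_of by metis
      then have evU: "eventually (\<lambda>x. f x \<in> U) F" using g[OF F(1)] by (simp add: limitin_def)
      have "g G \<in> V" if "G \<in> stone_cech_basic S {x. f x \<in> U}" for G
      proof (rule ccontr)
        assume "g G \<notin> V"
        have G: "G \<in> stone_cech S" "eventually (\<lambda>x. f x \<in> U) G"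
          using that by (auto simp: stone_cech_basic_def le_principal)
        have "openin Y (topspace Y - C)" using UC(2) by blast
        moreover have "g G \<in> topspace Y - C"
          using \<open>g G \<notin> V\<close> UC g[OF G(1)] by (auto simp: limitin_def)
        ultimately have "eventually (\<lambda>x. f x \<in> topspace Y - C) G"
          using g[OF G(1)] unfolding limitin_def by blast
        with G(2) have "eventually (\<lambda>x. False) G"
          by eventually_elim (use UC in blast)
        with G(1) show False by (simp add: stone_cech_def ultrafilter_def eventually_False)
      qed
      then have "stone_cech_basic S {x. f x \<in> U} \<subseteq> {F \<in> topspace (stone_cech_topology S). g F \<in> V}"
        by (auto simp: stone_cech_basic_def)
      moreover have "F \<in> stone_cech_basic S {x. f x \<in> U}"
        using F evU by (simp add: stone_cech_basic_def le_principal)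
      ultimately show "\<exists>A. F \<in> stone_cech_basic S A \<and>
          stone_cech_basic S A \<subseteq> {F \<in> topspace (stone_cech_topology S). g F \<in> V}" by blast
    qed auto
  qed
  ultimately show ?thesis by blast
qed


section \<open>The coarse groupoid\<close>

record ('u, 'g) groupoid =
  objects :: "'u set"
  arrows :: "'g set"
  rng :: "'g \<Rightarrow> 'u"
  src :: "'g \<Rightarrow> 'u"
  unit_arrow :: "'u \<Rightarrow> 'g"
  inv_arrow :: "'g \<Rightarrow> 'g"
  comp_arrow :: "'g \<Rightarrow> 'g \<Rightarrow> 'g"

text \<open>The groupoid of an equivalence relation \<open>E\<close> on \<open>U\<close>; \<open>\<xi>\<close> is identified with \<open>(\<xi>, \<xi>)\<close>.\<close>

definition relation_groupoid :: "'u set \<Rightarrow> ('u \<times> 'u) set \<Rightarrow> ('u, 'u \<times> 'u) groupoid" where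
  "relation_groupoid U E = \<lparr>objects = U, arrows = E, rng = fst, src = snd,
     unit_arrow = (\<lambda>\<xi>. (\<xi>, \<xi>)), inv_arrow = prod.swap, comp_arrow = (\<lambda>g h. (fst g, snd h))\<rparr>"

definition entourage :: "'a set \<Rightarrow> ('a \<Rightarrow> 'a \<Rightarrow> real) \<Rightarrow> real \<Rightarrow> ('a \<times> 'a) set" where
  "entourage S d R = {(x, y) \<in> S \<times> S. d x y \<le> R}"

abbreviation stone_cech_square :: "'a set \<Rightarrow> ('a filter \<times> 'a filter) topology" where
  "stone_cech_square S \<equiv> prod_topology (stone_cech_topology S) (stone_cech_topology S)"

definition entourage_closure ::
    "'a set \<Rightarrow> ('a \<Rightarrow> 'a \<Rightarrow> real) \<Rightarrow> real \<Rightarrow> ('a filter \<times> 'a filter) set" where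
  "entourage_closure S d R = stone_cech_square S closure_of
     (map_prod principal_ultrafilter principal_ultrafilter ` entourage S d R)"

definition coarse_arrows :: "'a set \<Rightarrow> ('a \<Rightarrow> 'a \<Rightarrow> real) \<Rightarrow> ('a filter \<times> 'a filter) set" where
  "coarse_arrows S d = (\<Union>R\<in>{0<..}. entourage_closure S d R)"

definition coarse_groupoid ::
    "'a set \<Rightarrow> ('a \<Rightarrow> 'a \<Rightarrow> real) \<Rightarrow> ('a filter, 'a filter \<times> 'a filter) groupoid" where
  "coarse_groupoid S d = relation_groupoid (stone_cech S) (coarse_arrows S d)"

text \<open>In general finer than the subspace topology of the product.\<close>

definition coarse_topology ::
    "'a set \<Rightarrow> ('a \<Rightarrow> 'a \<Rightarrow> real) \<Rightarrow> ('a filter \<times> 'a filter) topology" where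
  "coarse_topology S d = topology (\<lambda>U. U \<subseteq> coarse_arrows S d \<and>
     (\<forall>R>0. openin (subtopology (stone_cech_square S) (entourage_closure S d R))
              (U \<inter> entourage_closure S d R)))"

definition coarse_boundary_groupoid ::
    "'a set \<Rightarrow> ('a \<Rightarrow> 'a \<Rightarrow> real) \<Rightarrow> ('a filter, 'a filter \<times> 'a filter) groupoid" where
  "coarse_boundary_groupoid S d = (coarse_groupoid S d)\<lparr>objects := stone_cech_boundary S,
     arrows := arrows (coarse_groupoid S d) \<inter> (stone_cech_boundary S \<times> stone_cech_boundary S)\<rparr>"

definition coarse_boundary_topology ::
    "'a set \<Rightarrow> ('a \<Rightarrow> 'a \<Rightarrow> real) \<Rightarrow> ('a filter \<times> 'a filter) topology" where
  "coarse_boundary_topology S d =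
     subtopology (coarse_topology S d) (stone_cech_boundary S \<times> stone_cech_boundary S)"

lemma openin_coarse_topology:
  "openin (coarse_topology S d) U \<longleftrightarrow> U \<subseteq> coarse_arrows S d \<and>
     (\<forall>R>0. openin (subtopology (stone_cech_square S) (entourage_closure S d R))
              (U \<inter> entourage_closure S d R))"
proof -
  have "istopology (\<lambda>U. U \<subseteq> coarse_arrows S d \<and>
     (\<forall>R>0. openin (subtopology (stone_cech_square S) (entourage_closure S d R))
              (U \<inter> entourage_closure S d R)))"
    unfolding istopology_def
  proof (intro conjI allI impI)
    fix U V R assume U: "U \<subseteq> coarse_arrows S d \<and>
       (\<forall>R>0. openin (subtopology (stone_cech_square S) (entourage_closure S d R))
              (U \<inter> entourage_closure S d R))"
      and V: "V \<subseteq> coarse_arrows S d \<and>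
       (\<forall>R>0. openin (subtopology (stone_cech_square S) (entourage_closure S d R))
              (V \<inter> entourage_closure S d R))"
    show "U \<inter> V \<subseteq> coarse_arrows S d" using U by blast
    assume "(0::real) < R"
    with U V have "openin (subtopology (stone_cech_square S) (entourage_closure S d R))
         (U \<inter> entourage_closure S d R)"
      "openin (subtopology (stone_cech_square S) (entourage_closure S d R))
         (V \<inter> entourage_closure S d R)"
      by blast+
    then have "openin (subtopology (stone_cech_square S) (entourage_closure S d R))
       ((U \<inter> entourage_closure S d R) \<inter> (V \<inter> entourage_closure S d R))"
      by (rule openin_Int)
    moreover have "(U \<inter> entourage_closure S d R) \<inter> (V \<inter> entourage_closure S d R)
        = U \<inter> V \<inter> entourage_closure S d R" by blast
    ultimately show "openin (subtopology (stone_cech_square S) (entourage_closure S d R))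
       (U \<inter> V \<inter> entourage_closure S d R)"
      by simp
  next
    fix \<K> R assume K: "\<forall>K\<in>\<K>. K \<subseteq> coarse_arrows S d \<and>
       (\<forall>R>0. openin (subtopology (stone_cech_square S) (entourage_closure S d R))
              (K \<inter> entourage_closure S d R))"
    then show "\<Union> \<K> \<subseteq> coarse_arrows S d" by blast
    assume "(0::real) < R"
    with K have "openin (subtopology (stone_cech_square S) (entourage_closure S d R))
       (\<Union>K\<in>\<K>. K \<inter> entourage_closure S d R)"
      by (intro openin_Union) blast
    moreover have "(\<Union>K\<in>\<K>. K \<inter> entourage_closure S d R) = \<Union> \<K> \<inter> entourage_closure S d R"
      by blast
    ultimately show "openin (subtopology (stone_cech_square S) (entourage_closure S d R))
       (\<Union> \<K> \<inter> entourage_closure S d R)"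
      by simp
  qed
  then show ?thesis by (simp add: coarse_topology_def)
qed

lemma topspace_coarse_topology [simp]: "topspace (coarse_topology S d) = coarse_arrows S d"
proof
  show "topspace (coarse_topology S d) \<subseteq> coarse_arrows S d"
    using openin_topspace openin_coarse_topology by blast
  have "openin (coarse_topology S d) (coarse_arrows S d)"
    unfolding openin_coarse_topology
  proof (intro conjI allI impI)
    fix R :: real assume "0 < R"
    then have "coarse_arrows S d \<inter> entourage_closure S d R = entourage_closure S d R"
      by (auto simp: coarse_arrows_def)
    moreover have "entourage_closure S d R \<subseteq> topspace (stone_cech_square S)"
      unfolding entourage_closure_def by (rule closure_of_subset_topspace)
    ultimately show "openin (subtopology (stone_cech_square S) (entourage_closure S d R))
       (coarse_arrows S d \<inter> entourage_closure S d R)"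
      by (metis inf.absorb2 openin_topspace topspace_subtopology)
  qed simp
  then show "coarse_arrows S d \<subseteq> topspace (coarse_topology S d)" by (rule openin_subset)
qed

lemma in_entourage_closure_iff:
  "(F, G) \<in> entourage_closure S d R \<longleftrightarrow> F \<in> stone_cech S \<and> G \<in> stone_cech S \<and>
     (\<forall>A. F \<le> principal A \<longrightarrow> G \<le> principal {y. \<exists>x\<in>A. (x, y) \<in> entourage S d R})"
proof safe
  assume FG: "(F, G) \<in> entourage_closure S d R"
  show F: "F \<in> stone_cech S" and G: "G \<in> stone_cech S"
    using FG closure_of_subset_topspace unfolding entourage_closure_def by fastforce+
  fix A assume A: "F \<le> principal A"
  let ?N = "{y. \<exists>x\<in>A. (x, y) \<in> entourage S d R}"
  show "G \<le> principal ?N"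
  proof (rule ccontr)
    assume "\<not> G \<le> principal ?N"
    then have "G \<le> principal (- ?N)"
      using G ultrafilter_le_principal_Compl by (auto simp: stone_cech_def)
    with A F G have "(F, G) \<in> stone_cech_basic S A \<times> stone_cech_basic S (- ?N)"
      by (simp add: stone_cech_basic_def)
    moreover have "openin (stone_cech_square S) (stone_cech_basic S A \<times> stone_cech_basic S (- ?N))"
      by (simp add: openin_prod_Times_iff openin_stone_cech_basic)
    ultimately obtain p where
      "p \<in> map_prod principal_ultrafilter principal_ultrafilter ` entourage S d R"
      "p \<in> stone_cech_basic S A \<times> stone_cech_basic S (- ?N)"
      using FG unfolding entourage_closure_def in_closure_of by meson
    then show False
      by (auto simp: stone_cech_basic_def principal_ultrafilter_def)
  qed
next
  assume F: "F \<in> stone_cech S" and G: "G \<in> stone_cech S"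
    and N: "\<forall>A. F \<le> principal A \<longrightarrow> G \<le> principal {y. \<exists>x\<in>A. (x, y) \<in> entourage S d R}"
  show "(F, G) \<in> entourage_closure S d R"
    unfolding entourage_closure_def in_closure_of
  proof (intro conjI allI impI)
    show "(F, G) \<in> topspace (stone_cech_square S)" using F G by simp
    fix W assume "(F, G) \<in> W \<and> openin (stone_cech_square S) W"
    then obtain U V where "openin (stone_cech_topology S) U" "openin (stone_cech_topology S) V"
      "F \<in> U" "G \<in> V" "U \<times> V \<subseteq> W"
      unfolding openin_prod_topology_alt by meson
    then obtain A B where AB: "F \<in> stone_cech_basic S A" "G \<in> stone_cech_basic S B"
      "stone_cech_basic S A \<times> stone_cech_basic S B \<subseteq> W"
      unfolding openin_stone_cech_iff by (meson Sigma_mono order_trans)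
    then have "eventually (\<lambda>y. y \<in> B \<and> (\<exists>x\<in>A. (x, y) \<in> entourage S d R)) G"
      using N by (auto simp: stone_cech_basic_def le_principal eventually_conj_iff)
    moreover have "G \<noteq> bot" using G by (simp add: stone_cech_def ultrafilter_def)
    ultimately obtain x y where xy: "x \<in> A" "y \<in> B" "(x, y) \<in> entourage S d R"
      using eventually_happens' by blast
    then have "principal_ultrafilter x \<in> stone_cech_basic S A"
      "principal_ultrafilter y \<in> stone_cech_basic S B"
      using principal_ultrafilter_in_stone_cech[of x S] principal_ultrafilter_in_stone_cech[of y S]
      by (auto simp: entourage_def stone_cech_basic_def principal_ultrafilter_def)
    then have "(principal_ultrafilter x, principal_ultrafilter y) \<in> W"
      using AB(3) by blast
    with xy(3) show "\<exists>p. p \<in> map_prod principal_ultrafilter principal_ultrafilter `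
        entourage S d R \<and> p \<in> W"
      by (metis imageI map_prod_simp)
  qed
qed

text \<open>Hence the coarse groupoid is indeed the groupoid of an equivalence relation.\<close>

lemma equiv_coarse_arrows:
  assumes "Metric_space S d"
  shows "equiv (stone_cech S) (coarse_arrows S d)"
proof -
  interpret Metric_space S d by fact
  have sub: "coarse_arrows S d \<subseteq> stone_cech S \<times> stone_cech S"
    by (auto simp: coarse_arrows_def in_entourage_closure_iff)
  have "(F, F) \<in> entourage_closure S d 1" if F: "F \<in> stone_cech S" for F
    unfolding in_entourage_closure_iff
  proof (intro conjI allI impI F)
    fix A assume "F \<le> principal A"
    with F have "eventually (\<lambda>x. x \<in> A \<and> x \<in> S) F"
      by (auto simp: stone_cech_def le_principal eventually_conj_iff)
    then show "F \<le> principal {y. \<exists>x\<in>A. (x, y) \<in> entourage S d 1}"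
      unfolding le_principal by (rule eventually_mono) (auto simp: entourage_def)
  qed
  then have refl: "\<forall>F\<in>stone_cech S. (F, F) \<in> coarse_arrows S d"
    unfolding coarse_arrows_def using zero_less_one by blast
  have sym: "(G, F) \<in> entourage_closure S d R" if FG: "(F, G) \<in> entourage_closure S d R" for F G R
    unfolding in_entourage_closure_iff
  proof (intro conjI allI impI)
    show F: "F \<in> stone_cech S" and G: "G \<in> stone_cech S"
      using FG by (auto simp: in_entourage_closure_iff)
    fix B assume B: "G \<le> principal B"
    let ?N = "{y. \<exists>x\<in>B. (x, y) \<in> entourage S d R}"
    show "F \<le> principal ?N"
    proof (rule ccontr)
      assume "\<not> F \<le> principal ?N"
      then have "F \<le> principal (- ?N)"
        using F ultrafilter_le_principal_Compl by (auto simp: stone_cech_def)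
      then have "G \<le> principal {y. \<exists>x\<in>- ?N. (x, y) \<in> entourage S d R}"
        using FG in_entourage_closure_iff by blast
      also have "\<dots> \<le> principal (- B)" by (auto simp: entourage_def commute)
      finally show False using B G ultrafilter_le_principal_Compl by (auto simp: stone_cech_def)
    qed
  qed
  have trans: "(F, H) \<in> entourage_closure S d (R + R')"
    if FG: "(F, G) \<in> entourage_closure S d R" and GH: "(G, H) \<in> entourage_closure S d R'"
    for F G H R R'
    unfolding in_entourage_closure_iff
  proof (intro conjI allI impI)
    show "F \<in> stone_cech S" "H \<in> stone_cech S" using FG GH by (auto simp: in_entourage_closure_iff)
    fix A assume "F \<le> principal A"
    then have "G \<le> principal {y. \<exists>x\<in>A. (x, y) \<in> entourage S d R}"
      using FG by (auto simp: in_entourage_closure_iff)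
    then have "H \<le> principal {z. \<exists>y\<in>{y. \<exists>x\<in>A. (x, y) \<in> entourage S d R}.
        (y, z) \<in> entourage S d R'}"
      using GH unfolding in_entourage_closure_iff by blast
    also have "\<dots> \<le> principal {y. \<exists>x\<in>A. (x, y) \<in> entourage S d (R + R')}"
      unfolding principal_le_iff
    proof safe
      fix z y x assume "x \<in> A" "(x, y) \<in> entourage S d R" "(y, z) \<in> entourage S d R'"
      moreover from this have "d x z \<le> R + R'"
        using triangle[of x y z] by (auto simp: entourage_def)
      ultimately show "\<exists>x\<in>A. (x, z) \<in> entourage S d (R + R')"
        by (auto simp: entourage_def)
    qed
    finally show "H \<le> principal {y. \<exists>x\<in>A. (x, y) \<in> entourage S d (R + R')}" .
  qed
  show ?thesis
  proof (rule equivI)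
    show "refl_on (stone_cech S) (coarse_arrows S d)"
      using refl by (auto intro: refl_onI)
    show "sym (coarse_arrows S d)"
      using sym by (auto simp: sym_def coarse_arrows_def)
    show "trans (coarse_arrows S d)"
    proof (rule transI)
      fix F G H assume "(F, G) \<in> coarse_arrows S d" "(G, H) \<in> coarse_arrows S d"
      then obtain R R' where "0 < R" "0 < R'" "(F, G) \<in> entourage_closure S d R"
        "(G, H) \<in> entourage_closure S d R'" by (auto simp: coarse_arrows_def)
      then have "0 < R + R'" "(F, H) \<in> entourage_closure S d (R + R')" using trans by auto
      then show "(F, H) \<in> coarse_arrows S d" by (auto simp: coarse_arrows_def)
    qed
  qed (use sub in auto)
qed


section \<open>Topological a-T-menability\<close>

definition cond_neg_definite :: "('u, 'g) groupoid \<Rightarrow> ('g \<Rightarrow> real) \<Rightarrow> bool" where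
  "cond_neg_definite G \<psi> \<longleftrightarrow>
     (\<forall>x\<in>objects G. \<psi> (unit_arrow G x) = 0) \<and>
     (\<forall>g\<in>arrows G. \<psi> g = \<psi> (inv_arrow G g)) \<and>
     (\<forall>x\<in>objects G. \<forall>n::nat. \<forall>y::nat \<Rightarrow> 'g. \<forall>l::nat \<Rightarrow> real.
        (\<forall>i<n. y i \<in> arrows G \<and> rng G (y i) = x) \<and> (\<Sum>i<n. l i) = 0 \<longrightarrow>
        (\<Sum>i<n. \<Sum>j<n. l i * l j * \<psi> (comp_arrow G (inv_arrow G (y i)) (y j))) \<le> 0)"

definition topologically_aTmenable :: "('u, 'g) groupoid \<Rightarrow> 'g topology \<Rightarrow> bool" where
  "topologically_aTmenable G T \<longleftrightarrow>
     (\<exists>\<psi>. cond_neg_definite G \<psi> \<and> continuous_map T euclideanreal \<psi> \<and>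
        (\<forall>K. compact K \<longrightarrow> compactin T {g \<in> topspace T. \<psi> g \<in> K}))"


section \<open>Asymptotic coarse embeddability\<close>

text \<open>The supremum in the diameter is unspecified for the empty set, for which the
  conclusion in the last clause is trivial.\<close>

definition asymptotically_coarsely_embeddable :: "(nat \<Rightarrow> ('v, 'e) pre_digraph) \<Rightarrow> bool" where
  "asymptotically_coarsely_embeddable X \<longleftrightarrow>
     (\<exists>(K :: nat \<Rightarrow> 'v \<Rightarrow> 'v \<Rightarrow> real) (\<rho>1 :: real \<Rightarrow> real) (\<rho>2 :: real \<Rightarrow> real) (R :: nat \<Rightarrow> real).
        (\<forall>i. \<forall>x\<in>verts (X i). \<forall>y\<in>verts (X i). K i x y = K i y x) \<and>
        mono_on {0..} \<rho>1 \<and> filterlim \<rho>1 at_top at_top \<and>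
        mono_on {0..} \<rho>2 \<and> filterlim \<rho>2 at_top at_top \<and>
        (\<forall>i. 0 \<le> R i) \<and> filterlim R at_top sequentially \<and>
        (\<forall>x. (\<forall>i. x i \<in> verts (X i)) \<longrightarrow> (\<lambda>i. K i (x i) (x i)) \<longlonglongrightarrow> 0) \<and>
        (\<forall>i. \<forall>x\<in>verts (X i). \<forall>y\<in>verts (X i).
           \<rho>1 (path_metric (X i) x y) \<le> K i x y \<and> K i x y \<le> \<rho>2 (path_metric (X i) x y)) \<and>
        (\<forall>i. \<forall>A l. A \<subseteq> verts (X i) \<and> (SUP (x, y) \<in> A \<times> A. path_metric (X i) x y) < 2 * R i \<and>
           (\<Sum>x\<in>A. l x) = 0 \<longrightarrow> (\<Sum>x\<in>A. \<Sum>y\<in>A. l x * l y * K i x y) \<le> 0))"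

end

theory Submission
  imports Defs
begin

text \<open>
  Let \<open>\<psi>\<close> be a proper continuous conditionally negative definite function on the coarse boundary
  groupoid.  The arrows in the closure of one entourage form a compact subset of \<open>\<beta>X \<times> \<beta>X\<close>, so the
  Tietze theorem extends \<open>\<psi>\<close> from there to a continuous function on \<open>\<beta>X \<times> \<beta>X\<close>.  The values of the
  extension at pairs of vertices give a kernel on every graph \<open>X\<^sub>i\<close> (\<open>kernel_limit_exists\<close>).

  The kernel resembles \<open>\<psi>\<close> more and more closely as \<open>i\<close> grows.  Suppose that for infinitely many
  \<open>i\<close> there is a configuration of \<open>M\<close> vertices of \<open>X\<^sub>i\<close>, at mutual distance at most \<open>r\<close>, that no
  \<open>M\<close> boundary points imitate: the kernel differs by at least \<open>\<eta>\<close> from the corresponding values of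
  \<open>\<psi>\<close>, or the distances are not reflected.  An ultrafilter on the
  set of these indices pushes the \<open>k\<close>-th vertices forward to a boundary point \<open>F\<^sub>k\<close>.  The pairs
  \<open>(F\<^sub>k, F\<^sub>l)\<close> are arrows, by continuity the kernel converges along the ultrafilter to
  \<open>\<psi> (F\<^sub>k, F\<^sub>l)\<close>, and a contradiction results (\<open>kernel_limit_continuous\<close>).  Because only one
  configuration is chosen in each graph, and distinct graphs are far apart, distances can be read
  off from the \<open>F\<^sub>k\<close>: if the \<open>k\<close>-th and \<open>l\<close>-th vertices stay further apart than \<open>R\<close>, then
  \<open>(F\<^sub>k, F\<^sub>l)\<close> is not in the closure of the entourage of radius \<open>R\<close>
  (\<open>vertex_sequences_notin_entourage_closure\<close>).  So for large \<open>i\<close> the kernel inherits three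
  properties at scale \<open>r\<close>: it is bounded in terms of the distance, since \<open>\<psi>\<close> is bounded on compact
  sets; it is large at large distances, since \<open>\<psi>\<close> is proper and a compact set of arrows lies in the
  closure of a single entourage (\<open>compactin_coarse_topology_bounded\<close>); and on sets of diameter at
  most \<open>r\<close> it is within \<open>\<eta>\<close> of a matrix of negative type.

  Negative type has to hold exactly.  With bounded degree, a set of diameter at most \<open>r\<close> has at most
  \<open>M\<close> points for some \<open>M\<close> depending on \<open>r\<close> alone.  Adding \<open>1\<close> to all off-diagonal entries lowers
  the quadratic form on coefficients of sum zero by the sum of their squares, which absorbs an error
  \<open>\<eta> \<le> 1 / M\<close> (\<open>negative_type_perturbation\<close>, \<open>kernel_limit_negative_type\<close>).

  Finally the scale is allowed to depend on \<open>i\<close> and to tend to infinity slowly enough that the three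
  properties hold in \<open>X\<^sub>i\<close> at its own scale \<open>n i\<close> (\<open>slow_selection\<close>).  At distances beyond that scale
  nothing is required except growth, and there the kernel is replaced by the metric.
\<close>


section \<open>Diagonal selection and perturbed kernels\<close>

text \<open>Any sequence of thresholds \<open>N c\<close> has a slow inverse: let \<open>s t\<close> be the largest \<open>c \<le> t\<close> whose
  threshold is below \<open>t\<close>.  It serves twice, to let the scale grow with the index of the graph and
  to turn the properness of \<open>\<psi>\<close> into a lower control function.\<close>

lemma slow_selection:
  fixes N :: "nat \<Rightarrow> real"
  obtains s :: "real \<Rightarrow> nat" where
    "mono s" "filterlim s at_top at_top" "\<And>t. s t = 0 \<or> N (s t) < t"
    "\<And>t. 0 \<le> t \<Longrightarrow> real (s t) \<le> t"
proof
  define A where "A t = insert 0 {c. real c \<le> t \<and> N c < t}" for t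
  define s where "s t = Max (A t)" for t
  have fin: "finite (A t)" for t
  proof -
    have "A t \<subseteq> {..nat \<lfloor>t\<rfloor>}" by (auto simp: A_def le_nat_floor)
    then show ?thesis by (rule finite_subset) simp
  qed
  have ne: "A t \<noteq> {}" for t by (simp add: A_def)
  have mem: "s t \<in> A t" for t unfolding s_def using fin ne by (rule Max_in)
  show "mono s"
  proof
    fix t u :: real assume "t \<le> u"
    then have "A t \<subseteq> A u" by (auto simp: A_def)
    then show "s t \<le> s u" unfolding s_def using ne fin by (rule Max_mono)
  qed
  show "s t = 0 \<or> N (s t) < t" "0 \<le> t \<Longrightarrow> real (s t) \<le> t" for t
    using mem[of t] by (auto simp: A_def)
  show "filterlim s at_top at_top"
    unfolding filterlim_at_top
  proof
    fix Z :: nat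
    show "\<forall>\<^sub>F t in at_top. Z \<le> s t"
      using eventually_gt_at_top[of "max (real Z) (N Z)"]
    proof eventually_elim
      case (elim t)
      then have "Z \<in> A t" by (simp add: A_def)
      then show "Z \<le> s t" unfolding s_def using fin by simp
    qed
  qed
qed

text \<open>If \<open>\<Sum> l i = 0\<close>, the matrix with \<open>0\<close> on and \<open>1\<close> off the diagonal has quadratic form
  \<open>- \<Sum> (l i)\<^sup>2\<close>, and entries bounded by \<open>\<eta>\<close> contribute at most \<open>\<eta> m \<Sum> (l i)\<^sup>2\<close>.\<close>

lemma negative_type_perturbation:
  fixes p K :: "nat \<Rightarrow> nat \<Rightarrow> real" and l :: "nat \<Rightarrow> real"
  assumes p: "(\<Sum>i<m. \<Sum>j<m. l i * l j * p i j) \<le> 0"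
    and l: "(\<Sum>i<m. l i) = 0"
    and diag: "\<And>i. i < m \<Longrightarrow> p i i = 0" "\<And>i. i < m \<Longrightarrow> K i i = 0"
    and near: "\<And>i j. i < m \<Longrightarrow> j < m \<Longrightarrow> i \<noteq> j \<Longrightarrow> \<bar>K i j - 1 - p i j\<bar> \<le> \<eta>"
    and \<eta>: "0 \<le> \<eta>" "\<eta> * m \<le> 1"
  shows "(\<Sum>i<m. \<Sum>j<m. l i * l j * K i j) \<le> 0"
proof -
  let ?e = "\<lambda>i j. l i * l j * p i j + l i * l j - (if i = j then (l i)\<^sup>2 else 0)
      + \<eta> / 2 * (l i)\<^sup>2 + \<eta> / 2 * (l j)\<^sup>2"
  \<comment> \<open>The two error terms come from \<open>\<bar>l i * l j\<bar> \<le> ((l i)\<^sup>2 + (l j)\<^sup>2) / 2\<close>.\<close>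
  have "l i * l j * K i j \<le> ?e i j" if "i < m" "j < m" for i j
  proof (cases "i = j")
    case True
    with that diag \<eta> show ?thesis by (simp add: power2_eq_square)
  next
    case False
    have "l i * l j * (K i j - 1 - p i j) \<le> \<bar>l i * l j\<bar> * \<bar>K i j - 1 - p i j\<bar>"
      by (metis abs_ge_self abs_mult)
    also have "\<dots> \<le> \<bar>l i * l j\<bar> * \<eta>"
      using near[OF that False] by (intro mult_left_mono) auto
    also have "\<dots> \<le> ((l i)\<^sup>2 + (l j)\<^sup>2) / 2 * \<eta>"
    proof (intro mult_right_mono \<eta>)
      have "0 \<le> (\<bar>l i\<bar> - \<bar>l j\<bar>)\<^sup>2" by simp
      then show "\<bar>l i * l j\<bar> \<le> ((l i)\<^sup>2 + (l j)\<^sup>2) / 2"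
        by (simp add: power2_diff abs_mult)
    qed
    finally show ?thesis using False by (simp add: algebra_simps add_divide_distrib)
  qed
  then have "(\<Sum>i<m. \<Sum>j<m. l i * l j * K i j) \<le> (\<Sum>i<m. \<Sum>j<m. ?e i j)"
    by (intro sum_mono) auto
  also have "\<dots> = (\<Sum>i<m. \<Sum>j<m. l i * l j * p i j) + (\<Sum>i<m. l i) * (\<Sum>i<m. l i)
      - (\<Sum>i<m. (l i)\<^sup>2) + \<eta> * m * (\<Sum>i<m. (l i)\<^sup>2)"
  proof -
    have "(\<Sum>i<m. \<Sum>j<m. if i = j then (l i)\<^sup>2 else 0) = (\<Sum>i<m. (l i)\<^sup>2)"
      by (intro sum.cong refl) simp
    moreover have "(\<Sum>i<m. \<Sum>j<m. \<eta> / 2 * (l i)\<^sup>2) = \<eta> / 2 * m * (\<Sum>i<m. (l i)\<^sup>2)"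
      by (simp add: sum_distrib_left mult_ac)
    moreover have "(\<Sum>i<m. \<Sum>j<m. \<eta> / 2 * (l j)\<^sup>2) = \<eta> / 2 * m * (\<Sum>i<m. (l i)\<^sup>2)"
      by (simp add: sum_distrib_left mult_ac)
    moreover have "(\<Sum>i<m. \<Sum>j<m. l i * l j) = (\<Sum>i<m. l i) * (\<Sum>i<m. l i)"
      by (rule sum_product[symmetric])
    ultimately show ?thesis
      unfolding sum.distrib sum_subtractf by linarith
  qed
  also have "\<dots> \<le> (\<eta> * m - 1) * (\<Sum>i<m. (l i)\<^sup>2)"
    using p l by (simp add: algebra_simps)
  also have "\<dots> \<le> 0"
    using \<eta> by (intro mult_nonpos_nonneg sum_nonneg) auto
  finally show ?thesis .
qed


section \<open>Points of the Stone-Cech boundary\<close>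

lemma ultrafilter_filtermap: "ultrafilter F \<Longrightarrow> ultrafilter (filtermap f F)"
  unfolding ultrafilter_def eventually_filtermap filtermap_bot_iff by blast

lemma filtermap_le_principal_iff: "filtermap f F \<le> principal A \<longleftrightarrow> (\<forall>\<^sub>F x in F. f x \<in> A)"
  by (simp add: le_principal eventually_filtermap)

lemma stone_cech_basic_singleton:
  assumes "x \<in> S"
  shows "stone_cech_basic S {x} = {principal_ultrafilter x}"
proof -
  have "F = principal {x}" if F: "F \<noteq> bot" "\<forall>\<^sub>F y in F. y = x" for F
  proof (rule filter_eqI)
    fix P
    have "P x" if "eventually P F"
      using eventually_happens'[OF F(1) eventually_conj[OF F(2) that]] by blast
    moreover have "eventually P F" if "P x"
      using F(2) by eventually_elim (use that in simp)
    ultimately show "eventually P F \<longleftrightarrow> eventually P (principal {x})"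
      by (auto simp: eventually_principal)
  qed
  then have "stone_cech_basic S {x} \<subseteq> {principal_ultrafilter x}"
    by (simp add: subset_iff stone_cech_basic_def stone_cech_def ultrafilter_def le_principal
        principal_ultrafilter_def)
  moreover have "principal_ultrafilter x \<in> stone_cech_basic S {x}"
    using principal_ultrafilter_in_stone_cech[OF assms]
    by (simp add: stone_cech_basic_def principal_ultrafilter_def)
  ultimately show ?thesis by blast
qed

text \<open>The principal ultrafilters are isolated points of the compactification.\<close>

lemma closedin_stone_cech_boundary:
  "closedin (stone_cech_topology S) (stone_cech_boundary S)"
proof -
  have "principal_ultrafilter ` S = (\<Union>x\<in>S. stone_cech_basic S {x})"
    by (auto simp: stone_cech_basic_singleton)
  moreover have "openin (stone_cech_topology S) (\<Union>x\<in>S. stone_cech_basic S {x})"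
    by (intro openin_Union) (auto simp: openin_stone_cech_basic)
  ultimately have "openin (stone_cech_topology S) (principal_ultrafilter ` S)" by simp
  from closedin_diff[OF closedin_topspace this] show ?thesis
    by (simp add: stone_cech_boundary_def)
qed

text \<open>The image of an ultrafilter \<open>U\<close> on an index set is the limit, along \<open>U\<close>, of the points that
  were indexed.\<close>

lemma limitin_stone_cech_filtermap:
  assumes "ultrafilter U" "\<forall>\<^sub>F i in U. x i \<in> S"
  shows "limitin (stone_cech_topology S) (\<lambda>i. principal_ultrafilter (x i)) (filtermap x U) U"
  unfolding limitin_def
proof (intro conjI allI impI)
  show "filtermap x U \<in> topspace (stone_cech_topology S)"
    using assms by (simp add: stone_cech_def ultrafilter_filtermap filtermap_le_principal_iff)
  fix W assume "openin (stone_cech_topology S) W \<and> filtermap x U \<in> W"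
  then obtain A where A: "filtermap x U \<in> stone_cech_basic S A" "stone_cech_basic S A \<subseteq> W"
    by (auto simp: openin_stone_cech_iff)
  then have "\<forall>\<^sub>F i in U. x i \<in> A"
    by (simp add: stone_cech_basic_def filtermap_le_principal_iff)
  then show "\<forall>\<^sub>F i in U. principal_ultrafilter (x i) \<in> W" using assms(2)
  proof eventually_elim
    case (elim i)
    then have "principal_ultrafilter (x i) \<in> stone_cech_basic S A"
      using principal_ultrafilter_in_stone_cech[of "x i" S]
      by (simp add: stone_cech_basic_def principal_ultrafilter_def)
    with A show ?case by blast
  qed
qed


section \<open>The topology of the coarse groupoid\<close>

lemma Hausdorff_stone_cech_square: "Hausdorff_space (stone_cech_square S)"
  by (simp add: Hausdorff_space_prod_topology Hausdorff_stone_cech)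

lemma compact_stone_cech_square: "compact_space (stone_cech_square S)"
  by (simp add: compact_space_prod_topology compact_stone_cech)

lemma entourage_closure_mono: "R \<le> R' \<Longrightarrow> entourage_closure S d R \<subseteq> entourage_closure S d R'"
  unfolding entourage_closure_def
  by (intro closure_of_mono image_mono) (auto simp: entourage_def)

abbreviation boundary_entourage ::
    "'a set \<Rightarrow> ('a \<Rightarrow> 'a \<Rightarrow> real) \<Rightarrow> real \<Rightarrow> ('a filter \<times> 'a filter) set" where
  "boundary_entourage S d r \<equiv>
     entourage_closure S d r \<inter> (stone_cech_boundary S \<times> stone_cech_boundary S)"

lemma closedin_boundary_entourage:
  "closedin (stone_cech_square S) (boundary_entourage S d r)"
  unfolding entourage_closure_def
  by (rule closedin_Int[OF closedin_closure_of])
    (simp add: closedin_prod_Times_iff closedin_stone_cech_boundary)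

text \<open>On a single closed entourage the groupoid topology is the subspace topology of the product, so
  that theorems about the compact space \<open>\<beta>S \<times> \<beta>S\<close> apply to \<open>\<psi>\<close> there.\<close>

lemma continuous_map_boundary_entourage:
  assumes "continuous_map (coarse_boundary_topology S d) Y \<psi>" and r: "0 < r"
  shows "continuous_map (subtopology (stone_cech_square S) (boundary_entourage S d r)) Y \<psi>"
proof -
  let ?C = "boundary_entourage S d r"
  have C: "?C \<subseteq> coarse_arrows S d" using r by (auto simp: coarse_arrows_def)
  have "continuous_map (subtopology (stone_cech_square S) ?C) (coarse_topology S d) id"
    unfolding continuous_map_def
  proof (intro conjI allI impI)
    show "id \<in> topspace (subtopology (stone_cech_square S) ?C) \<rightarrow> topspace (coarse_topology S d)"
      using C by auto
    fix U assume "openin (coarse_topology S d) U"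
    then obtain W where W: "openin (stone_cech_square S) W"
      "U \<inter> entourage_closure S d r = W \<inter> entourage_closure S d r"
      using r by (auto simp: openin_coarse_topology openin_subtopology)
    have "{p \<in> topspace (subtopology (stone_cech_square S) ?C). id p \<in> U} = W \<inter> ?C"
      using W(2) openin_subset[OF W(1)] by auto
    then show "openin (subtopology (stone_cech_square S) ?C)
        {p \<in> topspace (subtopology (stone_cech_square S) ?C). id p \<in> U}"
      using W(1) by (auto simp: openin_subtopology)
  qed
  then have "continuous_map (subtopology (stone_cech_square S) ?C) (coarse_boundary_topology S d) id"
    by (auto simp: coarse_boundary_topology_def continuous_map_in_subtopology)
  from continuous_map_compose[OF this assms(1)] show ?thesis by simp
qed

text \<open>In a union of an increasing sequence of closed Hausdorff pieces, topologized by its pieces, a set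
  that meets each piece in finitely many points is closed.  A sequence in \<open>K\<close> that leaves every
  piece would therefore be an infinite closed discrete subset of \<open>K\<close>; the open sets \<open>U m\<close>, which omit
  its tails, are a cover without a finite subcover.\<close>

lemma compactin_coarse_topology_bounded:
  assumes K: "compactin (coarse_topology S d) K"
  obtains r where "0 < r" "K \<subseteq> entourage_closure S d r"
proof (rule ccontr)
  assume "\<not> thesis"
  with that have "\<exists>p. p \<in> K \<and> p \<notin> entourage_closure S d (real n + 1)" for n :: nat
    by (meson add_nonneg_pos of_nat_0_le_iff subsetI zero_less_one)
  then obtain x where x: "\<And>n. x n \<in> K" "\<And>n. x n \<notin> entourage_closure S d (real n + 1)"
    by metis
  have small: "n < nat \<lceil>R\<rceil>" if "x n \<in> entourage_closure S d R" for n R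
  proof (rule ccontr)
    assume "\<not> n < nat \<lceil>R\<rceil>"
    then have "R \<le> real n + 1" by linarith
    then show False using that x(2) entourage_closure_mono by blast
  qed
  define U where "U m = coarse_arrows S d - x ` {m..}" for m
  have "openin (coarse_topology S d) (U m)" for m
    unfolding openin_coarse_topology
  proof (intro conjI allI impI)
    fix R :: real assume R: "0 < R"
    let ?E = "entourage_closure S d R"
    let ?T = "subtopology (stone_cech_square S) ?E"
    have sub: "x ` {m..} \<inter> ?E \<subseteq> x ` {..<nat \<lceil>R\<rceil>}" using small by auto
    have "?E \<subseteq> topspace (stone_cech_square S)"
      unfolding entourage_closure_def by (rule closure_of_subset_topspace)
    then have top: "topspace ?T = ?E" by auto
    have "closedin ?T (x ` {m..} \<inter> ?E)"
    proof (rule closedin_Hausdorff_finite)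
      show "Hausdorff_space ?T"
        using Hausdorff_stone_cech_square by (rule Hausdorff_space_subtopology)
    qed (use top finite_subset[OF sub] in auto)
    then have "openin ?T (?E - x ` {m..} \<inter> ?E)"
      using top by (metis openin_diff openin_topspace)
    moreover have "U m \<inter> ?E = ?E - x ` {m..} \<inter> ?E"
      using R by (auto simp: U_def coarse_arrows_def)
    ultimately show "openin ?T (U m \<inter> ?E)" by simp
  qed (auto simp: U_def)
  moreover have "K \<subseteq> \<Union> (range U)"
  proof
    fix p assume "p \<in> K"
    with compactin_subset_topspace[OF K] have "p \<in> coarse_arrows S d" by auto
    then obtain R where "0 < R" "p \<in> entourage_closure S d R" by (auto simp: coarse_arrows_def)
    have "p \<notin> x ` {nat \<lceil>R\<rceil>..}"
    proof
      assume "p \<in> x ` {nat \<lceil>R\<rceil>..}"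
      then obtain n where "nat \<lceil>R\<rceil> \<le> n" "p = x n" by auto
      with small[of n R] \<open>p \<in> entourage_closure S d R\<close> show False by simp
    qed
    then have "p \<in> U (nat \<lceil>R\<rceil>)"
      using \<open>p \<in> coarse_arrows S d\<close> by (simp add: U_def)
    then show "p \<in> \<Union> (range U)" by blast
  qed
  ultimately obtain \<F> where \<F>: "finite \<F>" "\<F> \<subseteq> range U" "K \<subseteq> \<Union> \<F>"
    using compactinD[OF K, of "range U"] by auto
  then obtain I where I: "finite I" "\<F> = U ` I" by (meson finite_subset_image)
  obtain m where m: "\<forall>i\<in>I. i \<le> m"
    using I(1) unfolding finite_nat_set_iff_bounded_le by (elim exE)
  have "x m \<in> (\<Union>i\<in>I. U i)" using x(1)[of m] \<F>(3) unfolding I(2) by (rule rev_subsetD)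
  then obtain i where "i \<in> I" "x m \<in> U i" by (elim UN_E)
  with m show False by (simp add: U_def)
qed


lemma continuous_bounded_on_boundary_entourage:
  assumes "continuous_map (coarse_boundary_topology S d) euclideanreal \<psi>"
  shows "\<exists>B. \<forall>p\<in>boundary_entourage S d r. \<psi> p \<le> B"
proof -
  let ?C = "boundary_entourage S d (max r 1)"
  have "compactin (stone_cech_square S) ?C"
    using compact_stone_cech_square closedin_boundary_entourage by (rule closedin_compact_space)
  then have "compactin (subtopology (stone_cech_square S) ?C) ?C"
    by (simp add: compactin_subtopology)
  then have "compactin euclideanreal (\<psi> ` ?C)"
    by (rule image_compactin) (rule continuous_map_boundary_entourage[OF assms], simp)
  then have "bounded (\<psi> ` ?C)" by (simp add: compact_imp_bounded)
  then obtain B where B: "\<forall>p\<in>?C. \<bar>\<psi> p\<bar> \<le> B" by (auto simp: bounded_iff)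
  have "boundary_entourage S d r \<subseteq> ?C"
    using entourage_closure_mono[of r "max r 1" S d] by auto
  with B show ?thesis by (intro exI[of _ B]) force
qed

section \<open>Balls in graphs of bounded degree\<close>

lemma (in fin_digraph) card_walk_ball_le:
  assumes D: "\<And>v. v \<in> verts G \<Longrightarrow> out_degree G v \<le> D"
  shows "finite {v. \<exists>p. awalk u p v \<and> length p \<le> k} \<and>
    card {v. \<exists>p. awalk u p v \<and> length p \<le> k} \<le> Suc D ^ k"
proof (induction k)
  case 0
  have "{v. \<exists>p. awalk u p v \<and> length p \<le> 0} \<subseteq> {u}"
    by (auto simp: awalk_Nil_iff)
  from card_mono[OF _ this] finite_subset[OF this] show ?case by simp
next
  case (Suc k)
  let ?B = "\<lambda>k. {v. \<exists>p. awalk u p v \<and> length p \<le> k}"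
  let ?N = "\<lambda>v. insert v (head G ` out_arcs G v)"
  have sub: "?B (Suc k) \<subseteq> (\<Union>v\<in>?B k. ?N v)"
  proof
    fix v assume "v \<in> ?B (Suc k)"
    then obtain p where p: "awalk u p v" "length p \<le> Suc k" by blast
    show "v \<in> (\<Union>v\<in>?B k. ?N v)"
    proof (cases p rule: rev_cases)
      case Nil
      with p have "v \<in> ?B k" by (intro CollectI exI[of _ p]) simp
      then show ?thesis by blast
    next
      case (snoc q e)
      with p have "awalk u q (tail G e)" "length q \<le> k" "e \<in> arcs G" "v = head G e"
        by (auto simp: awalk_simps)
      then have "tail G e \<in> ?B k" "v \<in> ?N (tail G e)" by (auto simp: out_arcs_def)
      then show ?thesis by blast
    qed
  qed
  have fin: "finite (?B k)" using Suc by blast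
  have N: "card (?N v) \<le> Suc D" if "v \<in> ?B k" for v
  proof -
    have "v \<in> verts G" using that by auto
    have "card (?N v) \<le> Suc (card (head G ` out_arcs G v))" by (rule card_insert_le_m1) simp_all
    also have "\<dots> \<le> Suc (card (out_arcs G v))" by (simp add: card_image_le out_arcs_def)
    also have "\<dots> \<le> Suc D" using D[OF \<open>v \<in> verts G\<close>] by (simp add: out_degree_def)
    finally show ?thesis .
  qed
  have finN: "finite (\<Union>v\<in>?B k. ?N v)"
    using fin by (auto simp: out_arcs_def)
  then have "card (?B (Suc k)) \<le> card (\<Union>v\<in>?B k. ?N v)"
    using sub by (rule card_mono)
  also have "\<dots> \<le> (\<Sum>v\<in>?B k. card (?N v))" using fin by (rule card_UN_le)
  also have "\<dots> \<le> (\<Sum>v\<in>?B k. Suc D)" using N by (rule sum_mono)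
  also have "\<dots> = card (?B k) * Suc D" by simp
  also have "\<dots> \<le> Suc D ^ k * Suc D" using Suc by (intro mult_le_mono1) blast
  finally show ?case using finite_subset[OF sub finN] by (simp add: mult.commute)
qed

text \<open>In a connected finite graph the infimum that defines the path-length metric is attained.\<close>

lemma path_metric_walk:
  assumes "graph G" "connected G" and uv: "u \<in> verts G" "v \<in> verts G" "path_metric G u v \<le> real k"
  obtains p where "pre_digraph.awalk G u p v" "length p \<le> k"
proof -
  interpret graph G by fact
  have "u \<rightarrow>\<^sup>*\<^bsub>mk_symmetric G\<^esub> v"
    using \<open>connected G\<close> uv by (simp add: connected_def strongly_connected_def)
  then have "u \<rightarrow>\<^sup>*\<^bsub>G\<^esub> v" by (simp add: reachable_mk_symmetric_eq[OF sym_arcs])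
  then obtain p where p: "apath u p v" "\<mu> (\<lambda>_. 1) u v = awalk_cost (\<lambda>_. 1) p"
    using min_cost_awalk[of u v "\<lambda>_. 1"] by auto
  then have "path_metric G u v = length p"
    by (simp add: path_metric_def awalk_cost_def sum_list_triv)
  with uv(3) p(1) show ?thesis by (intro that[of p]) (auto simp: apath_def)
qed


section \<open>Metric geometry of a space of graphs\<close>

context space_of_graphs
begin

abbreviation V where "V \<equiv> coarse_union X"

sublocale coarse: Metric_space V d by (rule metric)

lemma in_V [simp]: "(i, v) \<in> V \<longleftrightarrow> v \<in> verts (X i)"
  by (simp add: coarse_union_def)

lemma finite_verts_graph [simp]: "finite (verts (X i))"
proof -
  interpret graph "X i" by (rule finite_graph)
  show ?thesis by simp
qed

lemma bounded_subset_card_le: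
  assumes "uniformly_bounded_degree X"
  obtains M where "\<And>i A. A \<subseteq> verts (X i) \<Longrightarrow> (\<And>x y. x \<in> A \<Longrightarrow> y \<in> A \<Longrightarrow> d (i, x) (i, y) \<le> real k)
    \<Longrightarrow> card A \<le> M"
proof -
  obtain D where D: "\<And>i v. v \<in> verts (X i) \<Longrightarrow> out_degree (X i) v \<le> D"
    using assms by (auto simp: uniformly_bounded_degree_def)
  have "card A \<le> Suc D ^ k"
    if A: "A \<subseteq> verts (X i)" "\<And>x y. x \<in> A \<Longrightarrow> y \<in> A \<Longrightarrow> d (i, x) (i, y) \<le> real k" for i A
  proof (cases "A = {}")
    case False
    then obtain u where u: "u \<in> A" by blast
    interpret graph "X i" by (rule finite_graph)
    let ?B = "{v. \<exists>p. awalk u p v \<and> length p \<le> k}"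
    have "A \<subseteq> ?B"
    proof
      fix v assume v: "v \<in> A"
      then have "path_metric (X i) u v \<le> real k"
        using A u restricts[of u i v] by (metis subsetD)
      then obtain p where "awalk u p v" "length p \<le> k"
        using path_metric_walk[OF finite_graph connected_graph, of u i v k] u v A(1) by blast
      then show "v \<in> ?B" by blast
    qed
    then show ?thesis
      using card_walk_ball_le[OF D, of u k] card_mono by (meson order_trans)
  qed simp
  then show thesis by (rule that)
qed

text \<open>For nonnegative distances the infimum of the separation condition bounds each of them.\<close>

lemma components_far_apart:
  "\<exists>N. \<forall>i\<ge>N. \<forall>j. i \<noteq> j \<longrightarrow> (\<forall>u\<in>verts (X i). \<forall>v\<in>verts (X j). C < d (i, u) (j, v))"
proof -
  obtain N where N: "\<And>i j. i \<noteq> j \<Longrightarrow> N \<le> i + j \<Longrightarrow>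
      C + 1 \<le> (INF (u, v) \<in> verts (X i) \<times> verts (X j). d (i, u) (j, v))"
    using separated[of "C + 1"] by blast
  have "C < d (i, u) (j, v)" if "u \<in> verts (X i)" "v \<in> verts (X j)" "i \<noteq> j" "N \<le> i" for i j u v
  proof -
    have "C + 1 \<le> (INF (u, v) \<in> verts (X i) \<times> verts (X j). d (i, u) (j, v))"
      by (rule N[OF that(3)]) (use that(4) in simp)
    also have "\<dots> \<le> (\<lambda>(u, v). d (i, u) (j, v)) (u, v)"
    proof (rule cINF_lower)
      show "bdd_below ((\<lambda>(u, v). d (i, u) (j, v)) ` (verts (X i) \<times> verts (X j)))"
        by (rule bdd_belowI[of _ 0]) auto
    qed (use that in auto)
    finally show ?thesis by simp
  qed
  then show ?thesis by blast
qed

section \<open>Boundary points defined by vertex sequences\<close>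

context
  fixes U :: "nat filter"
  assumes U: "ultrafilter U" "U \<le> sequentially"
begin

lemma eventually_ge_U: "\<forall>\<^sub>F i in U. n \<le> i"
  using U(2) eventually_ge_at_top filter_leD by blast

text \<open>A principal limit would force the index of the graph to be constant along \<open>U\<close>.\<close>

lemma vertex_sequence_in_boundary:
  assumes a: "\<forall>\<^sub>F i in U. a i \<in> verts (X i)"
  shows "filtermap (\<lambda>i. (i, a i)) U \<in> stone_cech_boundary V"
proof -
  have "filtermap (\<lambda>i. (i, a i)) U \<in> stone_cech V"
    using U(1) a by (simp add: stone_cech_def ultrafilter_filtermap filtermap_le_principal_iff)
  moreover have "filtermap (\<lambda>i. (i, a i)) U \<noteq> principal_ultrafilter x" for x
  proof
    assume "filtermap (\<lambda>i. (i, a i)) U = principal_ultrafilter x"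
    then have "filtermap (\<lambda>i. (i, a i)) U \<le> principal {x}"
      by (simp add: principal_ultrafilter_def)
    then have "\<forall>\<^sub>F i in U. (i, a i) = x" by (simp add: filtermap_le_principal_iff)
    then have "\<forall>\<^sub>F i in U. False" using eventually_ge_U[of "Suc (fst x)"]
      by eventually_elim auto
    then show False using U(1) by (simp add: ultrafilter_def eventually_False)
  qed
  ultimately show ?thesis by (auto simp: stone_cech_boundary_def)
qed

lemma vertex_sequences_in_entourage_closure:
  assumes ab: "\<forall>\<^sub>F i in U. a i \<in> verts (X i)" "\<forall>\<^sub>F i in U. b i \<in> verts (X i)"
    and r: "\<forall>\<^sub>F i in U. d (i, a i) (i, b i) \<le> r"
  shows "(filtermap (\<lambda>i. (i, a i)) U, filtermap (\<lambda>i. (i, b i)) U) \<in> entourage_closure V d r"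
  unfolding in_entourage_closure_iff filtermap_le_principal_iff
proof (intro conjI allI impI)
  fix A assume "\<forall>\<^sub>F i in U. (i, a i) \<in> A"
  then show "\<forall>\<^sub>F i in U. (i, b i) \<in> {y. \<exists>x\<in>A. (x, y) \<in> entourage V d r}"
    using ab r
  proof eventually_elim
    case (elim i)
    then have "((i, a i), (i, b i)) \<in> entourage V d r" by (simp add: entourage_def)
    with elim(1) show ?case by blast
  qed
qed (use ab vertex_sequence_in_boundary in \<open>auto simp: stone_cech_boundary_def\<close>)

text \<open>The set \<open>A\<close> of the proof contains at most one vertex of each graph, and only of graphs that are
  further than \<open>R\<close> from all others.  So \<open>b j\<close> could be within \<open>R\<close> of \<open>A\<close> only by being within
  \<open>R\<close> of \<open>a j\<close>.\<close>

lemma vertex_sequences_notin_entourage_closure: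
  assumes ab: "\<forall>\<^sub>F i in U. a i \<in> verts (X i)" "\<forall>\<^sub>F i in U. b i \<in> verts (X i)"
    and R: "\<forall>\<^sub>F i in U. R < d (i, a i) (i, b i)"
  shows "(filtermap (\<lambda>i. (i, a i)) U, filtermap (\<lambda>i. (i, b i)) U) \<notin> entourage_closure V d R"
proof
  assume in_E: "(filtermap (\<lambda>i. (i, a i)) U, filtermap (\<lambda>i. (i, b i)) U) \<in> entourage_closure V d R"
  obtain N where N: "\<forall>i\<ge>N. \<forall>j. i \<noteq> j \<longrightarrow>
      (\<forall>u\<in>verts (X i). \<forall>v\<in>verts (X j). R < d (i, u) (j, v))"
    using components_far_apart[of R] by (elim exE)
  define A where "A = {(i, a i) |i. N \<le> i \<and> R < d (i, a i) (i, b i)}"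
  have "\<forall>\<^sub>F i in U. (i, a i) \<in> A"
    using R eventually_ge_U[of N] by eventually_elim (auto simp: A_def)
  with in_E have "\<forall>\<^sub>F j in U. \<exists>x\<in>A. (x, (j, b j)) \<in> entourage V d R"
    unfolding in_entourage_closure_iff filtermap_le_principal_iff by auto
  then have "\<forall>\<^sub>F j in U. False"
  proof eventually_elim
    case (elim j)
    then obtain i where i: "N \<le> i" "R < d (i, a i) (i, b i)" "a i \<in> verts (X i)" "b j \<in> verts (X j)"
      "d (i, a i) (j, b j) \<le> R"
      by (auto simp: A_def entourage_def)
    then show False using N by (cases "i = j") force+
  qed
  then show False using U(1) by (simp add: ultrafilter_def eventually_False)
qed

end

section \<open>Kernels converging to a function on arrows\<close>

definition close_vertices :: "nat \<Rightarrow> real \<Rightarrow> nat \<Rightarrow> (nat \<Rightarrow> 'v) \<Rightarrow> bool" where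
  "close_vertices M q i a \<longleftrightarrow>
     (\<forall>k<M. a k \<in> verts (X i)) \<and> (\<forall>k<M. \<forall>l<M. d (i, a k) (i, a l) \<le> q)"

text \<open>Boundary points \<open>F k\<close> standing in for the vertices \<open>a k\<close> of \<open>X i\<close>: they record that the distances
  are at most \<open>q\<close>, and which of them exceed \<open>R\<close>.\<close>

definition shadow ::
    "nat \<Rightarrow> real \<Rightarrow> real \<Rightarrow> nat \<Rightarrow> (nat \<Rightarrow> 'v) \<Rightarrow> (nat \<Rightarrow> (nat \<times> 'v) filter) \<Rightarrow> bool" where
  "shadow M q R i a F \<longleftrightarrow> (\<forall>k<M. F k \<in> stone_cech_boundary V) \<and>
     (\<forall>k<M. \<forall>l<M. (F k, F l) \<in> entourage_closure V d q \<and>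
        (R < d (i, a k) (i, a l) \<longrightarrow> (F k, F l) \<notin> entourage_closure V d R))"

text \<open>A sequence of kernels converges to a function on arrows, up to scale \<open>r\<close>, if late in the sequence
  every configuration of \<open>M\<close> close vertices has a shadow on which \<open>\<psi>\<close> takes nearly the same values.
  An approximate inequality between finitely many values of \<open>\<psi>\<close> then passes to the kernels.\<close>

definition kernel_limit ::
    "(nat \<Rightarrow> 'v \<Rightarrow> 'v \<Rightarrow> real) \<Rightarrow> ((nat \<times> 'v) filter \<times> (nat \<times> 'v) filter \<Rightarrow> real) \<Rightarrow> real \<Rightarrow> bool" where
  "kernel_limit f \<psi> r \<longleftrightarrow> (\<forall>q\<le>r. \<forall>R M. \<forall>\<eta>>0. \<forall>\<^sub>F i in sequentially. \<forall>a. close_vertices M q i a \<longrightarrow>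
     (\<exists>F. shadow M q R i a F \<and> (\<forall>k<M. \<forall>l<M. \<bar>f i (a k) (a l) - \<psi> (F k, F l)\<bar> < \<eta>)))"

text \<open>Configurations in infinitely many graphs that lack such a shadow would themselves yield one: push
  an ultrafilter on their indices forward along the \<open>k\<close>-th vertices.\<close>

lemma kernel_limit_continuous:
  assumes g: "continuous_map (stone_cech_square V) euclideanreal g"
  shows "kernel_limit
    (\<lambda>i x y. g (principal_ultrafilter (i, x), principal_ultrafilter (i, y))) g r"
  unfolding kernel_limit_def
proof (intro allI impI)
  fix q R \<eta> :: real and M :: nat assume "0 < \<eta>"
  define val where "val i x y = g (principal_ultrafilter (i, x), principal_ultrafilter (i, y))" for i x y
  let ?good = "\<lambda>i a F. shadow M q R i a F \<and> (\<forall>k<M. \<forall>l<M. \<bar>val i (a k) (a l) - g (F k, F l)\<bar> < \<eta>)"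
  have "\<forall>\<^sub>F i in sequentially. \<forall>a. close_vertices M q i a \<longrightarrow> (\<exists>F. ?good i a F)"
  proof (rule ccontr)
    assume no: "\<not> ?thesis"
    define bad where "bad = {i. \<exists>a. close_vertices M q i a \<and> (\<nexists>F. ?good i a F)}"
    have "inf sequentially (principal bad) \<noteq> bot"
    proof
      assume "inf sequentially (principal bad) = bot"
      then have "\<forall>\<^sub>F i in sequentially. i \<notin> bad"
        by (simp add: trivial_limit_def eventually_inf_principal)
      then have "\<forall>\<^sub>F i in sequentially. \<forall>a. close_vertices M q i a \<longrightarrow> (\<exists>F. ?good i a F)"
        by (rule eventually_mono) (simp add: bad_def)
      with no show False by simp
    qed
    then obtain U where U: "U \<le> inf sequentially (principal bad)" "ultrafilter U"
      using ultrafilter_exists by blast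
    then have U': "U \<le> sequentially" "U \<le> principal bad" by simp_all
    have "\<forall>i\<in>bad. \<exists>a. close_vertices M q i a \<and> (\<nexists>F. ?good i a F)" by (simp add: bad_def)
    from bchoice[OF this] obtain a where
      a: "\<forall>i\<in>bad. close_vertices M q i (a i) \<and> (\<nexists>F. ?good i (a i) F)" by (elim exE)
    have bad: "\<forall>\<^sub>F i in U. i \<in> bad" using U'(2) by (simp add: le_principal)
    then have close_a: "\<forall>\<^sub>F i in U. close_vertices M q i (a i)"
      by (rule eventually_mono) (use a in simp)
    define F where "F k = filtermap (\<lambda>i. (i, a i k)) U" for k
    have verts: "\<forall>\<^sub>F i in U. a i k \<in> verts (X i)" if "k < M" for k
      using close_a by (rule eventually_mono) (use that in \<open>simp add: close_vertices_def\<close>)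
    have close: "\<forall>\<^sub>F i in U. d (i, a i k) (i, a i l) \<le> q" if "k < M" "l < M" for k l
      using close_a by (rule eventually_mono) (use that in \<open>simp add: close_vertices_def\<close>)
    have lim: "((\<lambda>i. val i (a i k) (a i l)) \<longlongrightarrow> g (F k, F l)) U" if "k < M" "l < M" for k l
    proof -
      have "limitin (stone_cech_topology V) (\<lambda>i. principal_ultrafilter (i, a i m)) (F m) U"
        if "m < M" for m
        unfolding F_def by (rule limitin_stone_cech_filtermap[OF U(2)]) (use verts[OF that] in simp)
      then have "limitin (stone_cech_square V)
          (\<lambda>i. (principal_ultrafilter (i, a i k), principal_ultrafilter (i, a i l))) (F k, F l) U"
        using that by (simp add: limitin_pairwise o_def)
      from continuous_map_limit[OF g this] show ?thesis by (simp add: o_def val_def)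
    qed
    \<comment> \<open>Along an ultrafilter the distance eventually exceeds \<open>R\<close> or eventually does not.\<close>
    have far: "\<forall>\<^sub>F i in U. R < d (i, a i k) (i, a i l) \<longrightarrow> (F k, F l) \<notin> entourage_closure V d R"
      if "k < M" "l < M" for k l
    proof (cases "(F k, F l) \<in> entourage_closure V d R")
      case True
      then have "\<not> (\<forall>\<^sub>F i in U. R < d (i, a i k) (i, a i l))"
        using vertex_sequences_notin_entourage_closure[OF U(2) U'(1) verts verts] that
        unfolding F_def by blast
      then have "\<forall>\<^sub>F i in U. \<not> R < d (i, a i k) (i, a i l)"
        using U(2) by (simp add: ultrafilter_eventually_not)
      then show ?thesis by eventually_elim simp
    qed simp
    have "\<forall>\<^sub>F i in U. (R < d (i, a i k) (i, a i l) \<longrightarrow> (F k, F l) \<notin> entourage_closure V d R) \<and>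
        \<bar>val i (a i k) (a i l) - g (F k, F l)\<bar> < \<eta>" if "k < M" "l < M" for k l
      using far[OF that] tendstoD[OF lim[OF that] \<open>0 < \<eta>\<close>]
      by eventually_elim (auto simp: dist_real_def)
    then have "\<forall>\<^sub>F i in U. \<forall>k\<in>{..<M}. \<forall>l\<in>{..<M}.
        (R < d (i, a i k) (i, a i l) \<longrightarrow> (F k, F l) \<notin> entourage_closure V d R) \<and>
        \<bar>val i (a i k) (a i l) - g (F k, F l)\<bar> < \<eta>"
      by (intro eventually_ball_finite ballI) auto
    then have "\<forall>\<^sub>F i in U. False" using bad
    proof eventually_elim
      case (elim i)
      have "F k \<in> stone_cech_boundary V" if "k < M" for k
        unfolding F_def by (rule vertex_sequence_in_boundary[OF U(2) U'(1) verts[OF that]])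
      moreover have "(F k, F l) \<in> entourage_closure V d q" if "k < M" "l < M" for k l
        unfolding F_def
        by (rule vertex_sequences_in_entourage_closure
            [OF U(2) U'(1) verts[OF that(1)] verts[OF that(2)] close[OF that]])
      ultimately have "?good i (a i) F" using elim(1) unfolding shadow_def by simp
      then show False using a elim(2) by blast
    qed
    then show False using U(2) by (simp add: ultrafilter_def eventually_False)
  qed
  then show "\<forall>\<^sub>F i in sequentially. \<forall>a. close_vertices M q i a \<longrightarrow> (\<exists>F. shadow M q R i a F \<and>
      (\<forall>k<M. \<forall>l<M. \<bar>g (principal_ultrafilter (i, a k), principal_ultrafilter (i, a l)) - g (F k, F l)\<bar> < \<eta>))"
    by (simp only: val_def)
qed

text \<open>The Tietze extension of \<open>\<psi>\<close> need not be symmetric; averaging it with its transpose does not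
  change the values on arrows.\<close>

lemma kernel_limit_exists:
  assumes cont: "continuous_map (coarse_boundary_topology V d) euclideanreal \<psi>"
    and sym: "\<And>F G. (F, G) \<in> arrows (coarse_boundary_groupoid V d) \<Longrightarrow> \<psi> (F, G) = \<psi> (G, F)"
    and r: "0 < r"
  shows "\<exists>f. kernel_limit f \<psi> r \<and> (\<forall>i x y. f i x y = f i y x)"
proof -
  have "normal_space (stone_cech_square V)"
    using Hausdorff_stone_cech_square compact_stone_cech_square
    by (intro compact_Hausdorff_or_regular_imp_normal_space) auto
  then obtain g where g: "continuous_map (stone_cech_square V) euclideanreal g"
    and g_\<psi>: "\<And>p. p \<in> boundary_entourage V d r \<Longrightarrow> g p = \<psi> p"
    using Tietze_extension_realinterval[OF _ closedin_boundary_entourage is_interval_univ _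
        continuous_map_boundary_entourage[OF cont r]] by auto
  define h where "h i x y = g (principal_ultrafilter (i, x), principal_ultrafilter (i, y))" for i x y
  have h: "kernel_limit h g r" unfolding h_def using g by (rule kernel_limit_continuous)
  define f where "f i x y = (h i x y + h i y x) / 2" for i x y
  have "kernel_limit f \<psi> r"
    unfolding kernel_limit_def
  proof (intro allI impI)
    fix q R \<eta> :: real and M :: nat assume q: "q \<le> r" and "0 < \<eta>"
    with h have "\<forall>\<^sub>F i in sequentially. \<forall>a. close_vertices M q i a \<longrightarrow> (\<exists>F. shadow M q R i a F \<and>
        (\<forall>k<M. \<forall>l<M. \<bar>h i (a k) (a l) - g (F k, F l)\<bar> < \<eta>))"
      unfolding kernel_limit_def by simp
    then show "\<forall>\<^sub>F i in sequentially. \<forall>a. close_vertices M q i a \<longrightarrow> (\<exists>F. shadow M q R i a F \<and>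
        (\<forall>k<M. \<forall>l<M. \<bar>f i (a k) (a l) - \<psi> (F k, F l)\<bar> < \<eta>))"
    proof (rule eventually_mono, intro allI impI)
      fix i a assume *: "\<forall>a. close_vertices M q i a \<longrightarrow> (\<exists>F. shadow M q R i a F \<and>
        (\<forall>k<M. \<forall>l<M. \<bar>h i (a k) (a l) - g (F k, F l)\<bar> < \<eta>))" and "close_vertices M q i a"
      then obtain F where F: "shadow M q R i a F"
        and hF: "\<forall>k<M. \<forall>l<M. \<bar>h i (a k) (a l) - g (F k, F l)\<bar> < \<eta>"
        by (elim allE[of _ a] impE exE conjE)
      have "\<bar>f i (a k) (a l) - \<psi> (F k, F l)\<bar> < \<eta>" if kl: "k < M" "l < M" for k l
      proof -
        have B: "(F m, F n) \<in> boundary_entourage V d r" if "m < M" "n < M" for m n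
          using that F entourage_closure_mono[OF q, of V d] unfolding shadow_def by blast
        have "(F k, F l) \<in> arrows (coarse_boundary_groupoid V d)"
          using B[OF kl] r by (auto simp: coarse_boundary_groupoid_def coarse_groupoid_def
              relation_groupoid_def coarse_arrows_def)
        from sym[OF this] have "\<psi> (F l, F k) = \<psi> (F k, F l)" by (rule HOL.sym)
        then have "g (F k, F l) = \<psi> (F k, F l)" "g (F l, F k) = \<psi> (F k, F l)"
          using g_\<psi>[OF B[OF kl]] g_\<psi>[OF B[OF kl(2,1)]] by simp_all
        moreover have "\<bar>h i (a k) (a l) - g (F k, F l)\<bar> < \<eta>" "\<bar>h i (a l) (a k) - g (F l, F k)\<bar> < \<eta>"
          using hF kl by simp_all
        ultimately show ?thesis by (simp add: f_def abs_less_iff field_simps)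
      qed
      with F show "\<exists>F. shadow M q R i a F \<and> (\<forall>k<M. \<forall>l<M. \<bar>f i (a k) (a l) - \<psi> (F k, F l)\<bar> < \<eta>)"
        by (intro exI[of _ F]) simp
    qed
  qed
  moreover have "\<forall>i x y. f i x y = f i y x" by (simp add: f_def)
  ultimately show ?thesis by blast
qed

text \<open>Configurations of two vertices are all that the comparison with the metric needs.\<close>

lemma kernel_limit_pair:
  assumes f: "kernel_limit f \<psi> r" "q \<le> r" "0 \<le> q"
  shows "\<forall>\<^sub>F i in sequentially. \<forall>x\<in>verts (X i). \<forall>y\<in>verts (X i). d (i, x) (i, y) \<le> q \<longrightarrow>
    (\<exists>F\<in>stone_cech_boundary V. \<exists>G\<in>stone_cech_boundary V. (F, G) \<in> entourage_closure V d q \<and>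
       (R < d (i, x) (i, y) \<longrightarrow> (F, G) \<notin> entourage_closure V d R) \<and>
       \<bar>f i x y - \<psi> (F, G)\<bar> < 1)"
proof -
  have "\<forall>\<^sub>F i in sequentially. \<forall>a. close_vertices 2 q i a \<longrightarrow>
      (\<exists>F. shadow 2 q R i a F \<and> (\<forall>k<2. \<forall>l<2. \<bar>f i (a k) (a l) - \<psi> (F k, F l)\<bar> < 1))"
    using f(1,2) unfolding kernel_limit_def by simp
  then show ?thesis
  proof (rule eventually_mono, intro ballI impI)
    fix i x y
    assume *: "\<forall>a. close_vertices 2 q i a \<longrightarrow>
        (\<exists>F. shadow 2 q R i a F \<and> (\<forall>k<2. \<forall>l<2. \<bar>f i (a k) (a l) - \<psi> (F k, F l)\<bar> < 1))"
      and xy: "x \<in> verts (X i)" "y \<in> verts (X i)" "d (i, x) (i, y) \<le> q"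
    define a where "a k = (if k = 0 then x else y)" for k :: nat
    have "close_vertices 2 q i a"
      using xy f(3) by (simp add: close_vertices_def a_def coarse.commute[of "(i, y)" "(i, x)"])
    with * obtain F where F: "shadow 2 q R i a F"
      and near: "\<forall>k<2. \<forall>l<2. \<bar>f i (a k) (a l) - \<psi> (F k, F l)\<bar> < 1"
      by (elim allE[of _ a] impE exE conjE)
    have "F 0 \<in> stone_cech_boundary V" "F 1 \<in> stone_cech_boundary V"
      "(F 0, F 1) \<in> entourage_closure V d q"
      "R < d (i, x) (i, y) \<longrightarrow> (F 0, F 1) \<notin> entourage_closure V d R"
      "\<bar>f i x y - \<psi> (F 0, F 1)\<bar> < 1"
      using F near[rule_format, of 0 1] by (simp_all add: shadow_def a_def)
    then show "\<exists>F\<in>stone_cech_boundary V. \<exists>G\<in>stone_cech_boundary V.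
        (F, G) \<in> entourage_closure V d q \<and>
        (R < d (i, x) (i, y) \<longrightarrow> (F, G) \<notin> entourage_closure V d R) \<and>
        \<bar>f i x y - \<psi> (F, G)\<bar> < 1"
      by blast
  qed
qed

lemma kernel_limit_le:
  assumes f: "kernel_limit f \<psi> r" "q \<le> r" "0 \<le> q"
    and B: "\<And>p. p \<in> boundary_entourage V d q \<Longrightarrow> \<psi> p \<le> B"
  shows "\<forall>\<^sub>F i in sequentially. \<forall>x\<in>verts (X i). \<forall>y\<in>verts (X i).
    d (i, x) (i, y) \<le> q \<longrightarrow> f i x y \<le> B + 1"
proof (rule eventually_mono[OF kernel_limit_pair[OF f]], intro ballI impI)
  fix i x y
  assume "\<forall>x\<in>verts (X i). \<forall>y\<in>verts (X i). d (i, x) (i, y) \<le> q \<longrightarrow>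
      (\<exists>F\<in>stone_cech_boundary V. \<exists>G\<in>stone_cech_boundary V. (F, G) \<in> entourage_closure V d q \<and>
         (0 < d (i, x) (i, y) \<longrightarrow> (F, G) \<notin> entourage_closure V d 0) \<and> \<bar>f i x y - \<psi> (F, G)\<bar> < 1)"
    and "x \<in> verts (X i)" "y \<in> verts (X i)" "d (i, x) (i, y) \<le> q"
  then obtain F G where "F \<in> stone_cech_boundary V" "G \<in> stone_cech_boundary V"
    "(F, G) \<in> entourage_closure V d q" "\<bar>f i x y - \<psi> (F, G)\<bar> < 1"
    by blast
  with B[of "(F, G)"] show "f i x y \<le> B + 1" by simp
qed

lemma kernel_limit_ge:
  assumes f: "kernel_limit f \<psi> r" "0 \<le> r"
    and c: "\<And>p. p \<in> boundary_entourage V d r \<Longrightarrow> p \<notin> entourage_closure V d R \<Longrightarrow> c \<le> \<psi> p"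
  shows "\<forall>\<^sub>F i in sequentially. \<forall>x\<in>verts (X i). \<forall>y\<in>verts (X i).
    d (i, x) (i, y) \<le> r \<longrightarrow> R < d (i, x) (i, y) \<longrightarrow> c - 1 \<le> f i x y"
proof (rule eventually_mono[OF kernel_limit_pair[OF f(1) order_refl f(2)]], intro ballI impI)
  fix i x y
  assume "\<forall>x\<in>verts (X i). \<forall>y\<in>verts (X i). d (i, x) (i, y) \<le> r \<longrightarrow>
      (\<exists>F\<in>stone_cech_boundary V. \<exists>G\<in>stone_cech_boundary V. (F, G) \<in> entourage_closure V d r \<and>
         (R < d (i, x) (i, y) \<longrightarrow> (F, G) \<notin> entourage_closure V d R) \<and> \<bar>f i x y - \<psi> (F, G)\<bar> < 1)"
    and "x \<in> verts (X i)" "y \<in> verts (X i)" "d (i, x) (i, y) \<le> r" "R < d (i, x) (i, y)"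
  then obtain F G where "F \<in> stone_cech_boundary V" "G \<in> stone_cech_boundary V"
    "(F, G) \<in> entourage_closure V d r" "(F, G) \<notin> entourage_closure V d R"
    "\<bar>f i x y - \<psi> (F, G)\<bar> < 1"
    by blast
  with c[of "(F, G)"] show "c - 1 \<le> f i x y" by simp
qed

section \<open>Conditionally negative definite functions on the boundary\<close>

lemma cond_neg_definite_boundary:
  assumes "cond_neg_definite (coarse_boundary_groupoid V d) \<psi>"
  shows "F \<in> stone_cech_boundary V \<Longrightarrow> \<psi> (F, F) = 0"
    and "(F, G) \<in> arrows (coarse_boundary_groupoid V d) \<Longrightarrow> \<psi> (F, G) = \<psi> (G, F)"
    and "\<lbrakk>\<And>k. k < (m::nat) \<Longrightarrow> H k \<in> stone_cech_boundary V;
       \<And>k l. k < m \<Longrightarrow> l < m \<Longrightarrow> (H k, H l) \<in> coarse_arrows V d; (\<Sum>k<m. c k) = 0\<rbrakk>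
      \<Longrightarrow> (\<Sum>k<m. \<Sum>l<m. c k * c l * \<psi> (H k, H l)) \<le> 0"
proof -
  note defs = cond_neg_definite_def coarse_boundary_groupoid_def coarse_groupoid_def
    relation_groupoid_def
  show "F \<in> stone_cech_boundary V \<Longrightarrow> \<psi> (F, F) = 0"
    using assms by (simp add: defs)
  show "(F, G) \<in> arrows (coarse_boundary_groupoid V d) \<Longrightarrow> \<psi> (F, G) = \<psi> (G, F)"
    using assms by (auto simp: defs)
  assume H: "\<And>k. k < m \<Longrightarrow> H k \<in> stone_cech_boundary V"
    "\<And>k l. k < m \<Longrightarrow> l < m \<Longrightarrow> (H k, H l) \<in> coarse_arrows V d" and c: "(\<Sum>k<m. c k) = 0"
  show "(\<Sum>k<m. \<Sum>l<m. c k * c l * \<psi> (H k, H l)) \<le> 0"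
  proof (cases "m = 0")
    case False
    let ?G = "coarse_boundary_groupoid V d"
    have obj: "H 0 \<in> objects ?G" using False H(1)[of 0] by (simp add: defs)
    have arr: "\<forall>k<m. (H 0, H k) \<in> arrows ?G \<and> rng ?G (H 0, H k) = H 0"
      using False H by (simp add: defs)
    \<comment> \<open>The arrows \<open>(H 0, H k)\<close> share their range, and \<open>(H 0, H k)\<close> inverted, composed with
        \<open>(H 0, H l)\<close>, is \<open>(H k, H l)\<close>.\<close>
    have "(\<Sum>k<m. \<Sum>l<m. c k * c l *
        \<psi> (comp_arrow ?G (inv_arrow ?G (H 0, H k)) (H 0, H l))) \<le> 0"
      by (rule assms[unfolded cond_neg_definite_def, THEN conjunct2, THEN conjunct2, THEN bspec,
            OF obj, THEN spec[of _ m], THEN spec[of _ "\<lambda>k. (H 0, H k)"], THEN spec[of _ c],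
            THEN mp, OF conjI[OF arr c]])
    then show ?thesis by (simp add: defs)
  qed simp
qed

text \<open>The negative type inequality for the two arrows from \<open>F\<close> to \<open>F\<close> and to \<open>G\<close>, with coefficients
  \<open>1\<close> and \<open>- 1\<close>.\<close>

lemma cond_neg_definite_boundary_nonneg:
  assumes \<psi>: "cond_neg_definite (coarse_boundary_groupoid V d) \<psi>"
    and FG: "(F, G) \<in> arrows (coarse_boundary_groupoid V d)"
  shows "0 \<le> \<psi> (F, G)"
proof -
  let ?H = "\<lambda>k::nat. if k = 0 then F else G" and ?c = "\<lambda>k::nat. if k = 0 then 1 else - 1 :: real"
  have bd: "F \<in> stone_cech_boundary V" "G \<in> stone_cech_boundary V" and "(F, G) \<in> coarse_arrows V d"
    using FG by (auto simp: coarse_boundary_groupoid_def coarse_groupoid_def relation_groupoid_def)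
  moreover have "equiv (stone_cech V) (coarse_arrows V d)"
    using metric by (rule equiv_coarse_arrows)
  moreover have "F \<in> stone_cech V" "G \<in> stone_cech V"
    using bd by (auto simp: stone_cech_boundary_def)
  ultimately have "(?H k, ?H l) \<in> coarse_arrows V d" for k l
    by (auto simp: equiv_def sym_def dest: refl_onD)
  moreover have "?H k \<in> stone_cech_boundary V" for k using bd by simp
  moreover have "(\<Sum>k<2. ?c k) = 0" by (simp add: lessThan_nat_numeral lessThan_Suc numeral_2_eq_2)
  ultimately have "(\<Sum>k<2. \<Sum>l<2. ?c k * ?c l * \<psi> (?H k, ?H l)) \<le> 0"
    by (intro cond_neg_definite_boundary(3)[OF \<psi>])
  then have "\<psi> (F, F) - \<psi> (F, G) - \<psi> (G, F) + \<psi> (G, G) \<le> 0"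
    by (simp add: lessThan_Suc numeral_2_eq_2)
  then show ?thesis
    using cond_neg_definite_boundary(1)[OF \<psi>] cond_neg_definite_boundary(2)[OF \<psi> FG] bd by simp
qed

text \<open>Properness bounds the sublevel sets of \<open>\<psi>\<close>.  The value \<open>Q 0 = - 1\<close> expresses \<open>\<psi> \<ge> 0\<close> in the same
  form as the other levels: no pair of points is at distance at most \<open>- 1\<close>.\<close>

lemma proper_cond_neg_definite_large:
  assumes \<psi>: "cond_neg_definite (coarse_boundary_groupoid V d) \<psi>"
    and proper: "\<And>K. compact K \<Longrightarrow> compactin (coarse_boundary_topology V d)
      {g \<in> topspace (coarse_boundary_topology V d). \<psi> g \<in> K}"
  shows "\<exists>Q. Q 0 = - 1 \<and> (\<forall>c::nat. \<forall>r p. p \<in> boundary_entourage V d r \<longrightarrow> 0 < r \<longrightarrow>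
    p \<notin> entourage_closure V d (Q c) \<longrightarrow> real c \<le> \<psi> p)"
proof -
  let ?T = "coarse_boundary_topology V d"
  have in_T: "p \<in> topspace ?T" and nonneg: "0 \<le> \<psi> p"
    if "p \<in> boundary_entourage V d r" "0 < r" for p r
  proof -
    show "p \<in> topspace ?T"
      using that by (auto simp: coarse_arrows_def coarse_boundary_topology_def)
    have "(fst p, snd p) \<in> arrows (coarse_boundary_groupoid V d)"
      using that by (auto simp: coarse_boundary_groupoid_def coarse_groupoid_def
          relation_groupoid_def coarse_arrows_def)
    from cond_neg_definite_boundary_nonneg[OF \<psi> this] show "0 \<le> \<psi> p" by simp
  qed
  have "\<exists>q. (c = 0 \<longrightarrow> q = - 1) \<and> (\<forall>r p. p \<in> boundary_entourage V d r \<longrightarrow> 0 < r \<longrightarrow>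
      p \<notin> entourage_closure V d q \<longrightarrow> real c \<le> \<psi> p)" for c :: nat
  proof (cases "c = 0")
    case True
    with nonneg show ?thesis by (intro exI[of _ "- 1"]) auto
  next
    case False
    have "compactin ?T {g \<in> topspace ?T. \<psi> g \<in> {0..real c}}"
      by (rule proper) simp
    then have "compactin (coarse_topology V d) {g \<in> topspace ?T. \<psi> g \<in> {0..real c}}"
      by (simp add: coarse_boundary_topology_def compactin_subtopology)
    then obtain q where q: "{g \<in> topspace ?T. \<psi> g \<in> {0..real c}} \<subseteq> entourage_closure V d q"
      by (rule compactin_coarse_topology_bounded)
    have "real c \<le> \<psi> p"
      if p: "p \<in> boundary_entourage V d r" "0 < r" "p \<notin> entourage_closure V d q" for r p
    proof (rule ccontr)
      assume "\<not> real c \<le> \<psi> p"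
      then have "p \<in> {g \<in> topspace ?T. \<psi> g \<in> {0..real c}}"
        using in_T[OF p(1,2)] nonneg[OF p(1,2)] by simp
      with q p(3) show False by blast
    qed
    with False show ?thesis by blast
  qed
  then obtain Q where Q: "\<forall>c::nat. (c = 0 \<longrightarrow> Q c = - 1) \<and> (\<forall>r p. p \<in> boundary_entourage V d r \<longrightarrow> 0 < r \<longrightarrow>
      p \<notin> entourage_closure V d (Q c) \<longrightarrow> real c \<le> \<psi> p)"
    by metis
  then show ?thesis by (intro exI[of _ Q] conjI) blast+
qed

text \<open>The number \<open>M\<close> that bounds the size of \<open>A\<close> must be known before the accuracy \<open>\<eta>\<close> is chosen; this
  is where bounded degree enters.\<close>

lemma kernel_limit_negative_type:
  assumes bdd: "uniformly_bounded_degree X"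
    and \<psi>: "cond_neg_definite (coarse_boundary_groupoid V d) \<psi>"
    and f: "kernel_limit f \<psi> (real r)" and r: "0 < r"
  shows "\<forall>\<^sub>F i in sequentially. \<forall>A c. A \<subseteq> verts (X i) \<longrightarrow>
    (\<forall>x\<in>A. \<forall>y\<in>A. d (i, x) (i, y) \<le> r) \<longrightarrow> (\<Sum>x\<in>A. c x) = 0 \<longrightarrow>
    (\<Sum>x\<in>A. \<Sum>y\<in>A. c x * c y * (if x = y then 0 else f i x y + 1)) \<le> 0"
proof -
  obtain M where M: "\<And>i A. A \<subseteq> verts (X i) \<Longrightarrow>
      (\<And>x y. x \<in> A \<Longrightarrow> y \<in> A \<Longrightarrow> d (i, x) (i, y) \<le> real r) \<Longrightarrow> card A \<le> M"
    using bounded_subset_card_le[OF bdd] by metis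
  define \<eta> where "\<eta> = 1 / (real M + 1)"
  have \<eta>: "0 < \<eta>" "\<eta> * M \<le> 1" by (simp_all add: \<eta>_def field_simps)
  have "\<forall>\<^sub>F i in sequentially. \<forall>a. close_vertices M r i a \<longrightarrow>
      (\<exists>F. shadow M r 0 i a F \<and> (\<forall>k<M. \<forall>l<M. \<bar>f i (a k) (a l) - \<psi> (F k, F l)\<bar> < \<eta>))"
    using f \<eta>(1) unfolding kernel_limit_def by simp
  then show ?thesis
  proof eventually_elim
    case (elim i)
    show ?case
    proof (intro allI impI)
      fix A and c :: "'v \<Rightarrow> real"
      assume A: "A \<subseteq> verts (X i)" "\<forall>x\<in>A. \<forall>y\<in>A. d (i, x) (i, y) \<le> r" and c: "(\<Sum>x\<in>A. c x) = 0"
      let ?K = "\<lambda>x y. if x = y then 0 else f i x y + 1"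
      show "(\<Sum>x\<in>A. \<Sum>y\<in>A. c x * c y * ?K x y) \<le> 0"
      proof (cases "A = {}")
        case False
        then obtain x0 where x0: "x0 \<in> A" by blast
        have "finite A" using A(1) finite_verts_graph by (rule finite_subset)
        then obtain h where h: "bij_betw h {..<card A} A"
          using bij_betw_from_nat_into_finite by blast
        have m: "card A \<le> M" using M A by blast
        \<comment> \<open>Configurations have exactly \<open>M\<close> entries, so the enumeration of \<open>A\<close> is padded.\<close>
        define a where "a k = (if k < card A then h k else x0)" for k
        have "a k \<in> A" for k
          using h x0 bij_betwE by (fastforce simp: a_def)
        then have "close_vertices M r i a"
          using A unfolding close_vertices_def by blast
        with elim obtain F where shadow: "shadow M r 0 i a F"
          and near: "\<forall>k<M. \<forall>l<M. \<bar>f i (a k) (a l) - \<psi> (F k, F l)\<bar> < \<eta>"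
          by (elim allE[of _ a] impE exE conjE)
        have F: "\<forall>k<M. F k \<in> stone_cech_boundary V"
          "\<forall>k<M. \<forall>l<M. (F k, F l) \<in> entourage_closure V d r"
          using shadow by (simp_all add: shadow_def)
        have "(\<Sum>k<card A. \<Sum>l<card A. c (h k) * c (h l) * ?K (h k) (h l)) \<le> 0"
        proof (rule negative_type_perturbation[where p = "\<lambda>k l. \<psi> (F k, F l)" and \<eta> = \<eta>])
          show csum: "(\<Sum>k<card A. c (h k)) = 0"
            using sum.reindex_bij_betw[OF h, of c] c by simp
          show "(\<Sum>k<card A. \<Sum>l<card A. c (h k) * c (h l) * \<psi> (F k, F l)) \<le> 0"
            by (rule cond_neg_definite_boundary(3)[OF \<psi> _ _ csum])
              (use F m r in \<open>auto simp: coarse_arrows_def intro!: bexI[of _ "real r"]\<close>)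
          show "\<psi> (F k, F k) = 0" if "k < card A" for k
            using cond_neg_definite_boundary(1)[OF \<psi>] F(1) m that by simp
          show "\<bar>?K (h k) (h l) - 1 - \<psi> (F k, F l)\<bar> \<le> \<eta>"
            if "k < card A" "l < card A" "k \<noteq> l" for k l
          proof -
            have "h k \<noteq> h l"
              using h that by (auto simp: bij_betw_def inj_on_def)
            moreover have "\<bar>f i (h k) (h l) - \<psi> (F k, F l)\<bar> < \<eta>"
              using near[rule_format, of k l] that m by (simp add: a_def)
            ultimately show ?thesis by simp
          qed
          show "\<eta> * real (card A) \<le> 1"
            using \<eta> m by (meson less_imp_le mult_left_mono of_nat_mono order_trans)
        qed (use \<eta> in simp_all)
        moreover have "(\<Sum>x\<in>A. \<Sum>y\<in>A. c x * c y * ?K x y) =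
            (\<Sum>k<card A. \<Sum>l<card A. c (h k) * c (h l) * ?K (h k) (h l))"
          by (simp only: sum.reindex_bij_betw[OF h, symmetric])
        ultimately show ?thesis by simp
      qed simp
    qed
  qed
qed

end

section \<open>Asymptotic coarse embeddability from the boundary groupoid\<close>

theorem theoremB:
  fixes X :: "nat \<Rightarrow> ('v, 'e) pre_digraph"
    and d :: "nat \<times> 'v \<Rightarrow> nat \<times> 'v \<Rightarrow> real"
  assumes "space_of_graphs X d"
    and "uniformly_bounded_degree X"
    and "topologically_aTmenable (coarse_boundary_groupoid (coarse_union X) d)
           (coarse_boundary_topology (coarse_union X) d)"
  shows "asymptotically_coarsely_embeddable X"
proof -
  interpret space_of_graphs X d by fact
  obtain \<psi> where \<psi>: "cond_neg_definite (coarse_boundary_groupoid V d) \<psi>"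
    and cont: "continuous_map (coarse_boundary_topology V d) euclideanreal \<psi>"
    and proper: "\<And>K. compact K \<Longrightarrow>
      compactin (coarse_boundary_topology V d) {g \<in> topspace (coarse_boundary_topology V d). \<psi> g \<in> K}"
    using assms(3) unfolding topologically_aTmenable_def by blast
  have "\<forall>c::nat. \<exists>B. \<forall>p\<in>boundary_entourage V d (real c). \<psi> p \<le> B"
    using continuous_bounded_on_boundary_entourage[OF cont] by blast
  then obtain B where B: "\<And>c p. p \<in> boundary_entourage V d (real c) \<Longrightarrow> \<psi> p \<le> B c" by metis
  obtain Q where Q0: "Q 0 = - 1"
    and Q: "\<And>c r p. \<lbrakk>p \<in> boundary_entourage V d r; 0 < r; p \<notin> entourage_closure V d (Q c)\<rbrakk> \<Longrightarrow>
      real c \<le> \<psi> p"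
    using proper_cond_neg_definite_large[OF \<psi> proper] by metis

  have "\<exists>f. kernel_limit f \<psi> (real (2 * n + 2)) \<and> (\<forall>i x y. f i x y = f i y x)" for n :: nat
    by (rule kernel_limit_exists[OF cont cond_neg_definite_boundary(2)[OF \<psi>]]) simp_all
  then obtain f where f: "\<And>n. kernel_limit (f n) \<psi> (real (2 * n + 2))"
    and f_sym: "\<And>n i x y. f n i x y = f n i y x" by metis
  \<comment> \<open>The three properties of the kernel \<open>f n\<close> on \<open>X i\<close> at scale \<open>n\<close>.  The two units beyond
      \<open>2 * n\<close> keep the radius positive for \<open>n = 0\<close>.\<close>
  define good where "good n i \<longleftrightarrow>
     (\<forall>c\<le>2 * n + 2. \<forall>x\<in>verts (X i). \<forall>y\<in>verts (X i). d (i, x) (i, y) \<le> real c \<longrightarrow>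
        f n i x y \<le> B c + 1) \<and>
     (\<forall>c\<le>2 * n + 2. \<forall>x\<in>verts (X i). \<forall>y\<in>verts (X i). d (i, x) (i, y) \<le> real (2 * n + 2) \<longrightarrow>
        Q c < d (i, x) (i, y) \<longrightarrow> real c - 1 \<le> f n i x y) \<and>
     (\<forall>A c. A \<subseteq> verts (X i) \<longrightarrow> (\<forall>x\<in>A. \<forall>y\<in>A. d (i, x) (i, y) \<le> real (2 * n + 2)) \<longrightarrow>
        (\<Sum>x\<in>A. c x) = 0 \<longrightarrow>
        (\<Sum>x\<in>A. \<Sum>y\<in>A. c x * c y * (if x = y then 0 else f n i x y + 1)) \<le> 0)" for n i
  have "\<forall>\<^sub>F i in sequentially. good n i" for n
  proof -
    let ?r = "2 * n + 2"
    have "\<forall>\<^sub>F i in sequentially. \<forall>c\<in>{..?r}. \<forall>x\<in>verts (X i). \<forall>y\<in>verts (X i).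
        d (i, x) (i, y) \<le> real c \<longrightarrow> f n i x y \<le> B c + 1"
    proof (intro eventually_ball_finite ballI)
      fix c assume "c \<in> {..?r}"
      then have c: "real c \<le> real ?r" by simp
      show "\<forall>\<^sub>F i in sequentially. \<forall>x\<in>verts (X i). \<forall>y\<in>verts (X i).
          d (i, x) (i, y) \<le> real c \<longrightarrow> f n i x y \<le> B c + 1"
        by (rule kernel_limit_le[OF f c of_nat_0_le_iff B])
    qed simp
    moreover have "\<forall>\<^sub>F i in sequentially. \<forall>c\<in>{..?r}. \<forall>x\<in>verts (X i). \<forall>y\<in>verts (X i).
        d (i, x) (i, y) \<le> real ?r \<longrightarrow> Q c < d (i, x) (i, y) \<longrightarrow> real c - 1 \<le> f n i x y"
    proof (intro eventually_ball_finite ballI)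
      fix c
      show "\<forall>\<^sub>F i in sequentially. \<forall>x\<in>verts (X i). \<forall>y\<in>verts (X i).
          d (i, x) (i, y) \<le> real ?r \<longrightarrow> Q c < d (i, x) (i, y) \<longrightarrow> real c - 1 \<le> f n i x y"
        by (rule kernel_limit_ge[OF f of_nat_0_le_iff Q[of _ "real ?r"]]) (assumption | simp)+
    qed simp
    moreover have "\<forall>\<^sub>F i in sequentially. \<forall>A c. A \<subseteq> verts (X i) \<longrightarrow>
        (\<forall>x\<in>A. \<forall>y\<in>A. d (i, x) (i, y) \<le> real ?r) \<longrightarrow> (\<Sum>x\<in>A. c x) = 0 \<longrightarrow>
        (\<Sum>x\<in>A. \<Sum>y\<in>A. c x * c y * (if x = y then 0 else f n i x y + 1)) \<le> 0"
      by (rule kernel_limit_negative_type[OF assms(2) \<psi> f]) simp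
    ultimately show ?thesis
    proof eventually_elim
      case (elim i)
      show ?case unfolding good_def
        using elim(1) elim(2) by (intro conjI elim(3)) simp_all
    qed
  qed
  then have "\<forall>n. \<exists>N. \<forall>i\<ge>N. good n i" by (simp add: eventually_sequentially)
  then obtain N where N: "\<And>n i. N n \<le> i \<Longrightarrow> good n i" by metis

  obtain s :: "real \<Rightarrow> nat" where s: "filterlim s at_top at_top"
    "\<And>t. s t = 0 \<or> real (N (s t)) < t"
    by (rule slow_selection[of "\<lambda>n. real (N n)"]) blast
  define n where "n i = s (real i)" for i
  have n_top: "filterlim n at_top sequentially"
    unfolding n_def by (rule filterlim_compose[OF s(1) filterlim_real_sequentially])
  have n_good: "good (n i) i" if "n i \<noteq> 0" for i
    using s(2)[of "real i"] that N[of "n i" i] by (simp add: n_def)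

  obtain b :: "real \<Rightarrow> nat" where b: "mono b" "filterlim b at_top at_top"
    "\<And>t. b t = 0 \<or> Q (b t) < t" "\<And>t. 0 \<le> t \<Longrightarrow> real (b t) \<le> t"
    by (rule slow_selection[of Q]) blast
  \<comment> \<open>A value of \<open>\<psi>\<close> below \<open>c\<close> forces a distance of at most \<open>Q c\<close>, so \<open>\<psi>\<close> is at least \<open>b t\<close> at
      distance \<open>t\<close>; \<open>b t \<le> t\<close> makes the same bound valid where the kernel is the metric.\<close>
  define \<rho>1 where "\<rho>1 t = real (b t)" for t
  define \<rho>2 where "\<rho>2 t = t + 2 + (\<Sum>c\<le>nat \<lceil>t\<rceil>. \<bar>B c\<bar>)" for t
  \<comment> \<open>For the finitely many \<open>i\<close> with \<open>n i = 0\<close> this is the metric.\<close>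
  define K where "K i x y = (if x = y then 0 else if d (i, x) (i, y) < 2 * real (n i)
      then f (n i) i x y + 1 else d (i, x) (i, y))" for i x y
  have bounds: "\<rho>1 (d (i, x) (i, y)) \<le> K i x y \<and> K i x y \<le> \<rho>2 (d (i, x) (i, y))"
    if xy: "x \<in> verts (X i)" "y \<in> verts (X i)" for i x y
  proof -
    let ?t = "d (i, x) (i, y)"
    have t: "0 \<le> ?t" by simp
    have S: "0 \<le> (\<Sum>c\<le>nat \<lceil>?t\<rceil>. \<bar>B c\<bar>)" by (intro sum_nonneg) simp
    consider "x = y" | "x \<noteq> y" "2 * real (n i) \<le> ?t" | "x \<noteq> y" "?t < 2 * real (n i)" by linarith
    then show ?thesis
    proof cases
      case 1
      then have "?t = 0" using xy by simp
      with 1 S b(4)[of 0] show ?thesis by (simp add: K_def \<rho>1_def \<rho>2_def)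
    next
      case 2
      with S b(4)[OF t] show ?thesis by (simp add: K_def \<rho>1_def \<rho>2_def)
    next
      case 3
      then have "0 < real (n i)" using t by linarith
      then have "n i \<noteq> 0" by simp
      then have g: "good (n i) i" by (rule n_good)
      let ?c = "nat \<lceil>?t\<rceil>"
      have c: "?c \<le> 2 * n i + 2" "?t \<le> real ?c" "?t \<le> real (2 * n i + 2)"
        using 3 t by linarith+
      have "b ?t \<le> 2 * n i + 2" using b(4)[OF t] c(3) by linarith
      moreover have "Q (b ?t) < ?t"
      proof (cases "b ?t = 0")
        case True
        have "- 1 < ?t" using t by linarith
        with True Q0 show ?thesis by simp
      qed (use b(3)[of ?t] in simp)
      ultimately have "real (b ?t) - 1 \<le> f (n i) i x y"
        using g xy c(3) unfolding good_def by blast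
      moreover have "f (n i) i x y \<le> B ?c + 1"
        using g xy c unfolding good_def by blast
      moreover have "B ?c \<le> (\<Sum>c\<le>?c. \<bar>B c\<bar>)"
        using member_le_sum[of ?c "{..?c}" "\<lambda>c. \<bar>B c\<bar>"] by simp
      moreover have "K i x y = f (n i) i x y + 1" using 3 by (simp add: K_def)
      ultimately show ?thesis using t unfolding \<rho>1_def \<rho>2_def by linarith
    qed
  qed
  have neg: "(\<Sum>x\<in>A. \<Sum>y\<in>A. l x * l y * K i x y) \<le> 0"
    if A: "A \<subseteq> verts (X i)" "(SUP (x, y) \<in> A \<times> A. path_metric (X i) x y) < 2 * real (n i)"
      and l: "(\<Sum>x\<in>A. l x) = 0" for i A l
  proof (cases "A = {}")
    case False
    have "finite A" using A(1) finite_verts_graph by (rule finite_subset)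
    have close: "d (i, x) (i, y) < 2 * real (n i)" if "x \<in> A" "y \<in> A" for x y
    proof -
      have "d (i, x) (i, y) = (\<lambda>(x, y). path_metric (X i) x y) (x, y)"
        using restricts A(1) that by auto
      also have "\<dots> \<le> (SUP (x, y) \<in> A \<times> A. path_metric (X i) x y)"
        by (rule cSUP_upper) (use that \<open>finite A\<close> in auto)
      finally show ?thesis using A(2) by simp
    qed
    obtain x0 where "x0 \<in> A" using False by blast
    then have "0 < 2 * real (n i)"
      using close[of x0 x0] coarse.nonneg[of "(i, x0)" "(i, x0)"] by linarith
    then have "n i \<noteq> 0" by simp
    then have "good (n i) i" by (rule n_good)
    moreover have "\<forall>x\<in>A. \<forall>y\<in>A. d (i, x) (i, y) \<le> real (2 * n i + 2)"
      using close by fastforce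
    ultimately have "(\<Sum>x\<in>A. \<Sum>y\<in>A. l x * l y * (if x = y then 0 else f (n i) i x y + 1)) \<le> 0"
      using A(1) l unfolding good_def by blast
    also have "(\<Sum>x\<in>A. \<Sum>y\<in>A. l x * l y * (if x = y then 0 else f (n i) i x y + 1)) =
        (\<Sum>x\<in>A. \<Sum>y\<in>A. l x * l y * K i x y)"
      by (intro sum.cong refl) (simp add: K_def close)
    finally show ?thesis .
  qed simp

  show ?thesis
    unfolding asymptotically_coarsely_embeddable_def
  proof (intro exI conjI allI ballI impI)
    show "K i x y = K i y x" for i x y
      by (simp add: K_def f_sym[of _ _ x y] coarse.commute[of "(i, x)" "(i, y)"])
    show "mono_on {0..} \<rho>1" using b(1) by (auto simp: mono_on_def \<rho>1_def mono_def)
    show "filterlim \<rho>1 at_top at_top"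
      unfolding \<rho>1_def by (rule filterlim_compose[OF filterlim_real_sequentially b(2)])
    show "mono_on {0..} \<rho>2"
    proof (rule mono_onI)
      fix t u :: real assume "t \<le> u"
      then have "nat \<lceil>t\<rceil> \<le> nat \<lceil>u\<rceil>" by (intro nat_mono ceiling_mono)
      then have "(\<Sum>c\<le>nat \<lceil>t\<rceil>. \<bar>B c\<bar>) \<le> (\<Sum>c\<le>nat \<lceil>u\<rceil>. \<bar>B c\<bar>)"
        by (intro sum_mono2) simp_all
      with \<open>t \<le> u\<close> show "\<rho>2 t \<le> \<rho>2 u" by (simp add: \<rho>2_def)
    qed
    show "filterlim \<rho>2 at_top at_top"
    proof (rule filterlim_at_top_mono[OF filterlim_ident])
      show "\<forall>\<^sub>F t in at_top. t \<le> \<rho>2 t"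
        by (intro always_eventually allI) (simp add: \<rho>2_def sum_nonneg add_nonneg_nonneg)
    qed
    show "0 \<le> real (n i)" for i by simp
    show "filterlim (\<lambda>i. real (n i)) at_top sequentially"
      by (rule filterlim_compose[OF filterlim_real_sequentially n_top])
    show "(\<lambda>i. K i (x i) (x i)) \<longlonglongrightarrow> 0" for x by (simp add: K_def)
    fix i
    show "\<rho>1 (path_metric (X i) x y) \<le> K i x y" "K i x y \<le> \<rho>2 (path_metric (X i) x y)"
      if "x \<in> verts (X i)" "y \<in> verts (X i)" for x y
      using bounds[OF that] restricts[OF that] by simp_all
    show "(\<Sum>x\<in>A. \<Sum>y\<in>A. l x * l y * K i x y) \<le> 0"
      if "A \<subseteq> verts (X i) \<and> (SUP (x, y) \<in> A \<times> A. path_metric (X i) x y) < 2 * real (n i) \<and>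
        (\<Sum>x\<in>A. l x) = 0" for A l
      using that by (intro neg) auto
  qed
qed

end
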